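(* Let $\gamma$ be a fixed positive integer. The following estimates hold: $$\int_{\mathbb{T}^d}|\nabla\varphi|^2\omega^\gamma\,dx\ \ge\ \big(1-o_d(1)\big)\int_{\mathbb{T}^d}\varphi^2\omega^\gamma\,dx,\qquad\forall\,\varphi\in\dot{C}^1(\mathbb{T}^d);$$ $$\int_{\mathbb{T}^d}|\nabla\varphi|^2\omega^\gamma\,dx\ \ge\ \frac d2\big(1-o_d(1)\big)\int_{\mathbb{T}^d}\varphi^2\omega^{\gamma-1}\,dx,\qquad\forall\,\varphi\in\dot{C}^1(\mathbb{T}^d);$$ $$\int_{\mathbb{T}^d}|\Delta\varphi|^2\omega^\gamma\,dx\ \ge\ \big(1-o_d(1)\big)\int_{\mathbb{T}^d}|\nabla\varphi|^2\omega^\gamma\,dx,\qquad\forall\,\varphi\in\dot{C}^2(\mathbb{T}^d);$$ $$\int_{\mathbb{T}^d}|\Delta\varphi|^2\omega^\gamma\,dx\ \ge\ \frac d2\big(1-o_d(1)\big)\int_{\mathbb{T}^d}|\nabla\varphi|^2\omega^{\gamma-1}\,dx,\qquad\forall\,\varphi\in\dot{C}^2(\mathbb{T}^d).$$ Here each $o_d(1)$ denotes a quantity (possibly different in each estimate) depending only on $d$ and $\gamma$, independent of the test function $\varphi$, and tending to $0$ as $d\to\infty$.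
   Context: $\mathbb{T}^d=[-\pi,\pi]^d$, and functions on $\mathbb{T}^d$ are identified with functions on $\mathbb{R}^d$ that are $2\pi$-periodic in each variable: $C^k(\mathbb{T}^d)$ is the set of real-valued $\varphi\in C^k(\mathbb{R}^d)$ with $\varphi(x+2\pi e_j)=\varphi(x)$ for all $x\in\mathbb{R}^d$, $1\le j\le d$, where $\{e_j\}$ is the canonical basis. $\dot{C}^k(\mathbb{T}^d)$ is the subspace of $\varphi\in C^k(\mathbb{T}^d)$ with $\int_{\mathbb{T}^d}\varphi\,dx=0$. The weight is $\omega(x)=\sum_{j=1}^d\big(\sin\frac{x_j}{2}\big)^2$. $\nabla$ and $\Delta=\sum_j\partial_{x_j}^2$ are the usual gradient and Laplacian. *)

theory Defs
  imports "HOL-Analysis.Analysis"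
begin

text \<open>
  The dimension \<open>d\<close> tends to infinity in the theorem, so it has to be a term rather than a type.
  A point of $R^d$ is a function on the index set \<open>{..<d}\<close>, made total by extensionality, which
  matches the carrier of the product measure. The coordinates $x_1, \dots, x_d$ are
  \<open>x 0, \<dots>, x (d - 1)\<close>. Functions on $R^d$ have type \<open>(nat \<Rightarrow> real) \<Rightarrow> real\<close>; their values outside
  \<open>Rn d\<close> are never used.
\<close>

definition Rn :: "nat \<Rightarrow> (nat \<Rightarrow> real) set" where
  "Rn d = ({..<d} \<rightarrow>\<^sub>E UNIV)"

definition torus :: "nat \<Rightarrow> (nat \<Rightarrow> real) set" where
  "torus d = ({..<d} \<rightarrow>\<^sub>E {-pi..pi})"

definition leb :: "nat \<Rightarrow> (nat \<Rightarrow> real) measure" where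
  "leb d = (\<Pi>\<^sub>M j\<in>{..<d}. lborel)"

definition torus_integral :: "nat \<Rightarrow> ((nat \<Rightarrow> real) \<Rightarrow> real) \<Rightarrow> real" where
  "torus_integral d f = (LINT x:torus d|leb d. f x)"

definition partial_deriv :: "nat \<Rightarrow> ((nat \<Rightarrow> real) \<Rightarrow> real) \<Rightarrow> (nat \<Rightarrow> real) \<Rightarrow> real" where
  "partial_deriv j f x = deriv (\<lambda>t. f (x(j := t))) (x j)"

text \<open>
  $C^k(R^d)$: all iterated partial derivatives of order at most \<open>k\<close> exist and are continuous.
  Continuity refers to the product topology on \<open>nat \<Rightarrow> real\<close>, whose subspace topology
  on \<open>Rn d\<close> is the Euclidean one.
\<close>

fun Ck_Rn :: "nat \<Rightarrow> nat \<Rightarrow> ((nat \<Rightarrow> real) \<Rightarrow> real) \<Rightarrow> bool" where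
  "Ck_Rn 0 d f \<longleftrightarrow> continuous_on (Rn d) f"
| "Ck_Rn (Suc k) d f \<longleftrightarrow> continuous_on (Rn d) f \<and>
     (\<forall>j<d. (\<forall>x\<in>Rn d. (\<lambda>t. f (x(j := t))) differentiable (at (x j))) \<and>
            Ck_Rn k d (partial_deriv j f))"

definition Ck_torus :: "nat \<Rightarrow> nat \<Rightarrow> ((nat \<Rightarrow> real) \<Rightarrow> real) set" where
  "Ck_torus k d = {\<phi>. Ck_Rn k d \<phi> \<and> (\<forall>x\<in>Rn d. \<forall>j<d. \<phi> (x(j := x j + 2 * pi)) = \<phi> x)}"

definition Ck_torus_mean0 :: "nat \<Rightarrow> nat \<Rightarrow> ((nat \<Rightarrow> real) \<Rightarrow> real) set" where
  "Ck_torus_mean0 k d = {\<phi> \<in> Ck_torus k d. torus_integral d \<phi> = 0}"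

definition weight :: "nat \<Rightarrow> (nat \<Rightarrow> real) \<Rightarrow> real" where
  "weight d x = (\<Sum>j<d. (sin (x j / 2))\<^sup>2)"

definition grad_norm :: "nat \<Rightarrow> ((nat \<Rightarrow> real) \<Rightarrow> real) \<Rightarrow> (nat \<Rightarrow> real) \<Rightarrow> real" where
  "grad_norm d f x = L2_set (\<lambda>j. partial_deriv j f x) {..<d}"

definition laplacian :: "nat \<Rightarrow> ((nat \<Rightarrow> real) \<Rightarrow> real) \<Rightarrow> (nat \<Rightarrow> real) \<Rightarrow> real" where
  "laplacian d f x = (\<Sum>j<d. partial_deriv j (partial_deriv j f) x)"

end

theory Submission
  imports Defs "HOL-Probability.Probability"
begin

text \<open>
  The mean of a function over the torus is its integral against the product of uniform probability
  measures on the circle; all estimates are homogeneous, so they are proved for means. The point is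
  that the weight \<open>\<omega> = d/2 - (1/2) \<Sum> cos x\<^sub>j\<close> satisfies \<open>\<Delta>\<omega> = d/2 - \<omega>\<close> and \<open>|\<nabla>\<omega>|\<^sup>2 \<le> \<omega>\<close>. Testing the
  first identity against functions of \<open>\<omega>\<close> shows in what sense \<open>\<omega>\<close> concentrates at \<open>d/2\<close>, and no other
  information about the weight is used. Write \<open>D = E(|\<nabla>\<phi>|\<^sup>2 \<omega>\<^sup>k)\<close>, \<open>N = E(\<phi>\<^sup>2 \<omega>\<^sup>k)\<close>,
  \<open>X = (d/2) E(\<phi>\<^sup>2 \<omega>\<^sup>k\<^sup>-\<^sup>1)\<close> and \<open>J = E(\<phi> \<nabla>\<phi>\<cdot>\<nabla>\<omega> \<omega>\<^sup>k\<^sup>-\<^sup>1)\<close>. Every integral that carries \<open>\<nabla>\<omega>\<close>, such as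
  \<open>J\<close>, is at most of order \<open>d\<^sup>-\<^sup>1\<^sup>/\<^sup>2 (D + X)\<close>.

  Integrating \<open>\<phi>\<^sup>2 \<omega>\<^sup>k\<^sup>-\<^sup>1 \<Delta>\<omega>\<close> by parts gives \<open>X = N\<close> up to such errors (\<open>X_identity\<close>, a Hardy-type
  identity). The Poincare inequality of the torus, with its sharp constant 1, applied to
  \<open>\<psi> = \<phi> \<omega>\<^sup>k\<^sup>/\<^sup>2\<close> gives \<open>N - (E \<psi>)\<^sup>2 \<le> D\<close> up to such errors (\<open>N_le\<close>). Finally \<open>E \<psi>\<close> is negligible:
  since \<open>E \<phi> = 0\<close>, it equals \<open>E(\<psi> (1 - (d/2)\<^sup>k\<^sup>/\<^sup>2 \<omega>\<^sup>-\<^sup>k\<^sup>/\<^sup>2))\<close>, and the negative moments of \<open>\<omega>\<close>, controlled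
  recursively by the same integration by parts, show that the factor in brackets tends to 0 in mean
  square (\<open>mean_defect_le\<close>). Hence \<open>N \<le> (1 + o(1)) D\<close> and \<open>X \<le> (1 + o(1)) D\<close>, which are the two
  first-order inequalities.

  For the second-order ones, \<open>D = - E(\<phi> \<Delta>\<phi> \<omega>\<^sup>k) - k J\<close>. Bounding \<open>|\<phi> \<Delta>\<phi>|\<close> by
  \<open>(|\<Delta>\<phi>|\<^sup>2 + \<phi>\<^sup>2)/2\<close> and using the bound for \<open>N\<close> yields the third inequality with \<open>k = \<gamma>\<close>; splitting
  the product as \<open>(\<omega>/(d/2) |\<Delta>\<phi>|\<^sup>2 + (d/2)/\<omega> \<phi>\<^sup>2)/2\<close> and using the bound for \<open>X\<close> yields the
  fourth with \<open>k = \<gamma> - 1\<close>, where \<open>k = 0\<close> is included and \<open>\<omega>\<^sup>-\<^sup>1\<close> is singular.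

  Half-integer and negative powers of \<open>\<omega>\<close> need not be smooth at the zeros of \<open>\<omega>\<close>, so all this is
  done for \<open>\<omega> + \<delta>\<close> with bounds that do not depend on \<open>\<delta> > 0\<close>; then \<open>\<delta>\<close> tends to 0. For the
  finitely many dimensions that are too small for the argument, \<open>\<epsilon> = 1\<close> makes the claim trivial.

  The Poincare inequality on the torus comes from Wirtinger's inequality on the circle and the
  Efron-Stein inequality, which bounds the variance on a product space by the sum of the mean
  variances in the single coordinates.
\<close>

section \<open>Wirtinger's inequality on the circle\<close>

text \<open>
  For \<open>\<theta>(t) = l tan(l (t - m))\<close> one has \<open>\<theta>' = l\<^sup>2 + \<theta>\<^sup>2\<close>, so that
  \<open>u'\<^sup>2 - l\<^sup>2 u\<^sup>2 = (u' + u \<theta>)\<^sup>2 - (u\<^sup>2 \<theta>)'\<close>. The factor \<open>l < 1\<close> keeps \<open>\<theta>\<close> finite on closed intervals of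
  length up to \<open>pi\<close> centred at \<open>m\<close>.
\<close>
lemma weighted_energy_lower_bound:
  fixes u u' :: "real \<Rightarrow> real" and l m p q :: real
  assumes pq: "p \<le> q" and l: "0 < l" "l < 1"
    and near: "\<And>t. t \<in> {p..q} \<Longrightarrow> \<bar>t - m\<bar> \<le> pi / 2"
    and der: "\<And>t. t \<in> {p..q} \<Longrightarrow> (u has_real_derivative u' t) (at t)"
    and cont: "continuous_on {p..q} u'"
  shows "integral {p..q} (\<lambda>t. (u' t)\<^sup>2 - l\<^sup>2 * (u t)\<^sup>2)
    \<ge> (u p)\<^sup>2 * (l * tan (l * (p - m))) - (u q)\<^sup>2 * (l * tan (l * (q - m)))"
proof -
  define \<theta> where "\<theta> t = l * tan (l * (t - m))" for t
  define F where "F t = (u t)\<^sup>2 * \<theta> t" for t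
  define f where "f t = 2 * u t * u' t * \<theta> t + (u t)\<^sup>2 * (l\<^sup>2 + (\<theta> t)\<^sup>2)" for t
  have cu: "continuous_on {p..q} u"
    by (meson der continuous_at_imp_continuous_on DERIV_isCont)
  have cosn: "cos (l * (t - m)) \<noteq> 0" if "t \<in> {p..q}" for t
  proof -
    have "\<bar>l * (t - m)\<bar> = l * \<bar>t - m\<bar>" using l by (simp add: abs_mult)
    also have "\<dots> \<le> l * (pi / 2)" using near[OF that] l by (intro mult_left_mono) auto
    also have "\<dots> < pi / 2" using l by simp
    finally have "cos (l * (t - m)) > 0" by (intro cos_gt_zero_pi) auto
    then show ?thesis by simp
  qed
  have dt: "(\<theta> has_real_derivative (l\<^sup>2 + (\<theta> t)\<^sup>2)) (at t)" if "t \<in> {p..q}" for t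
  proof -
    have "(\<theta> has_real_derivative l * (inverse ((cos (l * (t - m)))\<^sup>2) * l)) (at t)"
      unfolding \<theta>_def using cosn[OF that] by (auto intro!: derivative_eq_intros)
    moreover have "l * (inverse ((cos (l * (t - m)))\<^sup>2) * l) = l\<^sup>2 + (\<theta> t)\<^sup>2"
    proof -
      have "inverse ((cos (l * (t - m)))\<^sup>2) = 1 + (tan (l * (t - m)))\<^sup>2"
        by (simp only: tan_sec[OF cosn[OF that]] power_inverse)
      then show ?thesis by (simp only: \<theta>_def power2_eq_square) (simp add: distrib_left distrib_right)
    qed
    ultimately show ?thesis by simp
  qed
  have c\<theta>: "continuous_on {p..q} \<theta>"
    by (meson dt continuous_at_imp_continuous_on DERIV_isCont)
  have dF: "(F has_vector_derivative f t) (at t within {p..q})" if "t \<in> {p..q}" for t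
  proof -
    have "(F has_real_derivative f t) (at t)"
      unfolding F_def f_def using der[OF that] dt[OF that]
      by (auto intro!: derivative_eq_intros simp: algebra_simps power2_eq_square)
    then show ?thesis
      by (simp add: has_real_derivative_iff_has_vector_derivative has_vector_derivative_at_within)
  qed
  have hf: "(f has_integral (F q - F p)) {p..q}"
    using fundamental_theorem_of_calculus[OF pq dF] .
  have int2: "(\<lambda>t. (u' t)\<^sup>2 - l\<^sup>2 * (u t)\<^sup>2) integrable_on {p..q}"
    by (intro integrable_continuous_real continuous_intros cu cont)
  have "- (F q - F p) \<le> integral {p..q} (\<lambda>t. (u' t)\<^sup>2 - l\<^sup>2 * (u t)\<^sup>2)"
  proof (rule has_integral_le[OF has_integral_neg[OF hf] integrable_integral[OF int2]])
    fix t assume "t \<in> {p..q}"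
    have "0 \<le> (u' t + u t * \<theta> t)\<^sup>2" by simp
    then show "- f t \<le> (u' t)\<^sup>2 - l\<^sup>2 * (u t)\<^sup>2"
      unfolding f_def by (simp add: power2_eq_square algebra_simps)
  qed
  then show ?thesis unfolding F_def \<theta>_def by simp
qed

text \<open>
  By periodicity some \<open>a\<close> satisfies \<open>f(a + pi) = f(a)\<close>. The function \<open>u = f - f(a)\<close> vanishes at both
  ends of the two half circles between \<open>a\<close> and \<open>a + pi\<close>, so the preceding bound on each of them, with
  \<open>m\<close> the midpoint, gives \<open>\<integral> u'\<^sup>2 \<ge> l\<^sup>2 \<integral> u\<^sup>2\<close> for all \<open>l < 1\<close>. The mean minimises the mean square
  deviation, which replaces \<open>f(a)\<close> by the mean of \<open>f\<close>.
\<close>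
lemma wirtinger:
  fixes f f' :: "real \<Rightarrow> real"
  assumes der: "\<And>t. (f has_real_derivative f' t) (at t)"
    and cont: "continuous_on UNIV f'"
    and per: "f pi = f (-pi)"
  shows "integral {-pi..pi} (\<lambda>t. (f t)\<^sup>2) - (integral {-pi..pi} f)\<^sup>2 / (2 * pi)
     \<le> integral {-pi..pi} (\<lambda>t. (f' t)\<^sup>2)"
proof -
  have cf: "continuous_on A f" for A
    by (meson der continuous_at_imp_continuous_on DERIV_isCont)
  have cf': "continuous_on A f'" for A using cont continuous_on_subset by blast
  obtain a where a: "-pi \<le> a" "a \<le> 0" "f (a + pi) = f a"
  proof -
    define g where "g t = f (t + pi) - f t" for t
    have cg: "continuous_on {-pi..0} g"
      unfolding g_def
      by (intro continuous_intros continuous_on_compose2[OF cf[of UNIV]]) auto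
    have g: "g (-pi) = - g 0" using per by (simp add: g_def)
    have "\<exists>x. -pi \<le> x \<and> x \<le> 0 \<and> g x = 0"
    proof (cases "g 0 \<ge> 0")
      case True then show ?thesis using IVT'[of g "-pi" 0 0] cg g by auto
    next
      case False then show ?thesis using IVT2'[of g 0 0 "-pi"] cg g by auto
    qed
    then show ?thesis using that by (auto simp: g_def)
  qed
  define u where "u t = f t - f a" for t
  have du: "(u has_real_derivative f' t) (at t)" for t
    unfolding u_def using der[of t] by (auto intro!: derivative_eq_intros)
  have cu: "continuous_on A u" for A unfolding u_def by (intro continuous_intros cf)
  have ua: "u a = 0" "u (a + pi) = 0" and up: "u pi = u (-pi)"
    using a per by (auto simp: u_def)
  have ilu: "(\<lambda>t. (f' t)\<^sup>2 - l\<^sup>2 * (u t)\<^sup>2) integrable_on {p..q}" for l p q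
    by (intro integrable_continuous_real continuous_intros cu cf')
  have iu: "(\<lambda>t. (u t)\<^sup>2) integrable_on {-pi..pi}" "(\<lambda>t. (f' t)\<^sup>2) integrable_on {-pi..pi}"
     "(\<lambda>t. (f t)\<^sup>2) integrable_on {-pi..pi}" "f integrable_on {-pi..pi}"
    by (intro integrable_continuous_real continuous_intros cu cf' cf)+
  have l: "l\<^sup>2 * integral {-pi..pi} (\<lambda>t. (u t)\<^sup>2) \<le> integral {-pi..pi} (\<lambda>t. (f' t)\<^sup>2)"
    if l: "0 < l" "l < 1" for l
  proof -
    have 1: "integral {-pi..a} (\<lambda>t. (f' t)\<^sup>2 - l\<^sup>2 * (u t)\<^sup>2)
      \<ge> (u (-pi))\<^sup>2 * (l * tan (l * (-pi - (a - pi / 2))))"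
      using weighted_energy_lower_bound[of "-pi" a l "a - pi/2" u f'] l a du cf' ua
      by (fastforce simp: abs_if)
    have 2: "integral {a..a+pi} (\<lambda>t. (f' t)\<^sup>2 - l\<^sup>2 * (u t)\<^sup>2) \<ge> 0"
      using weighted_energy_lower_bound[of a "a+pi" l "a + pi/2" u f'] l a du cf' ua
      by (fastforce simp: abs_if)
    have 3: "integral {a+pi..pi} (\<lambda>t. (f' t)\<^sup>2 - l\<^sup>2 * (u t)\<^sup>2)
      \<ge> - (u pi)\<^sup>2 * (l * tan (l * (pi - (a + 3 * pi / 2))))"
      using weighted_energy_lower_bound[of "a+pi" pi l "a + 3*pi/2" u f'] l a du cf' ua
      by (fastforce simp: abs_if)
    \<comment> \<open>One half circle is cut at \<open>pi\<close>; the boundary terms there cancel by periodicity.\<close>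
    have e: "-pi - (a - pi / 2) = pi - (a + 3 * pi / 2)" by simp
    have "integral {-pi..pi} (\<lambda>t. (f' t)\<^sup>2 - l\<^sup>2 * (u t)\<^sup>2) =
      integral {-pi..a} (\<lambda>t. (f' t)\<^sup>2 - l\<^sup>2 * (u t)\<^sup>2) +
      (integral {a..a+pi} (\<lambda>t. (f' t)\<^sup>2 - l\<^sup>2 * (u t)\<^sup>2) +
      integral {a+pi..pi} (\<lambda>t. (f' t)\<^sup>2 - l\<^sup>2 * (u t)\<^sup>2))"
      using a ilu by (simp add: Henstock_Kurzweil_Integration.integral_combine)
    also have "\<dots> \<ge> 0" using 1 2 3 unfolding e up by simp
    finally show ?thesis using iu
      by (simp add: Henstock_Kurzweil_Integration.integral_diff integrable_on_mult_right)
  qed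
  have main: "integral {-pi..pi} (\<lambda>t. (u t)\<^sup>2) \<le> integral {-pi..pi} (\<lambda>t. (f' t)\<^sup>2)"
  proof (rule tendsto_upperbound)
    show "((\<lambda>l. l\<^sup>2 * integral {-pi..pi} (\<lambda>t. (u t)\<^sup>2)) \<longlongrightarrow> integral {-pi..pi} (\<lambda>t. (u t)\<^sup>2)) (at_left 1)"
      by (auto intro!: tendsto_eq_intros)
    show "\<forall>\<^sub>F l in at_left 1. l\<^sup>2 * integral {-pi..pi} (\<lambda>t. (u t)\<^sup>2) \<le> integral {-pi..pi} (\<lambda>t. (f' t)\<^sup>2)"
      by (rule eventually_at_leftI[of 0]) (auto intro: l)
  qed auto
  have "integral {-pi..pi} (\<lambda>t. (u t)\<^sup>2) = integral {-pi..pi} (\<lambda>t. (f t)\<^sup>2 + (- 2 * f a * f t + (f a)\<^sup>2))"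
    by (intro integral_cong) (simp add: u_def power2_eq_square algebra_simps)
  also have "\<dots> = integral {-pi..pi} (\<lambda>t. (f t)\<^sup>2) + (integral {-pi..pi} (\<lambda>t. - 2 * f a * f t) + integral {-pi..pi} (\<lambda>t. (f a)\<^sup>2))"
    by (subst Henstock_Kurzweil_Integration.integral_add Henstock_Kurzweil_Integration.integral_add; 
        (intro integrable_continuous_real continuous_intros cf)?)+ simp
  also have "\<dots> = integral {-pi..pi} (\<lambda>t. (f t)\<^sup>2) - 2 * f a * integral {-pi..pi} f + 2 * pi * (f a)\<^sup>2"
    by simp
  also have "\<dots> \<ge> integral {-pi..pi} (\<lambda>t. (f t)\<^sup>2) - (integral {-pi..pi} f)\<^sup>2 / (2 * pi)"
  proof -
    have "0 \<le> (integral {-pi..pi} f - 2 * pi * f a)\<^sup>2 / (2 * pi)" by simp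
    also have "\<dots> = (integral {-pi..pi} f)\<^sup>2 / (2 * pi) - 2 * f a * integral {-pi..pi} f + 2 * pi * (f a)\<^sup>2"
      by (simp add: power2_eq_square field_simps)
    finally show ?thesis by simp
  qed
  finally show ?thesis using main by linarith
qed

section \<open>The Efron-Stein inequality\<close>

definition circ :: "real measure" where
  "circ = uniform_measure lborel {-pi..pi}"

abbreviation tor :: "nat set \<Rightarrow> (nat \<Rightarrow> real) measure" where
  "tor J \<equiv> PiM J (\<lambda>_. circ)"

lemma prob_space_circ: "prob_space circ"
  unfolding circ_def by (rule prob_space_uniform_measure) auto

lemma sets_circ [measurable_cong, simp]: "sets circ = sets borel"
  by (simp add: circ_def)

lemma space_circ [simp]: "space circ = UNIV"
  by (simp add: circ_def)

lemma circ_eq_density: "circ = density lborel (\<lambda>t. ennreal (indicator {-pi..pi} t / (2 * pi)))"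
  unfolding circ_def uniform_measure_def
  by (intro density_cong)
    (auto simp: divide_ennreal[of 1, simplified] split: split_indicator)

interpretation circ: prob_space circ by (rule prob_space_circ)

interpretation circ_prod: product_sigma_finite "\<lambda>_::nat. circ"
  by unfold_locales

lemma prob_space_tor: "prob_space (tor J)"
  by (intro prob_space_PiM prob_space_circ)

lemma integral_circ:
  fixes f :: "real \<Rightarrow> real"
  assumes "continuous_on {-pi..pi} f" and [measurable]: "f \<in> borel_measurable borel"
  shows "integral\<^sup>L circ f = integral {-pi..pi} f / (2 * pi)"
proof -
  have "integral\<^sup>L circ f = (\<integral>t. indicator {-pi..pi} t / (2 * pi) * f t \<partial>lborel)"
    unfolding circ_eq_density by (subst integral_density) auto
  also have "\<dots> = (\<integral>t. (1 / (2 * pi)) * (indicator {-pi..pi} t *\<^sub>R f t) \<partial>lborel)"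
    by (intro Bochner_Integration.integral_cong) auto
  also have "\<dots> = (1 / (2 * pi)) * (LINT t:{-pi..pi}|lborel. f t)"
    unfolding set_lebesgue_integral_def by (rule integral_mult_right_zero)
  also have "(LINT t:{-pi..pi}|lborel. f t) = integral {-pi..pi} f"
    by (intro set_borel_integral_eq_integral borel_integrable_atLeastAtMost') (use assms in auto)
  finally show ?thesis by simp
qed

lemma (in prob_space) bounded_integral_AE:
  fixes f :: "'a \<Rightarrow> real"
  assumes [measurable]: "f \<in> borel_measurable M" and b: "AE x in M. \<bar>f x\<bar> \<le> C"
  shows "integrable M f" and "\<bar>integral\<^sup>L M f\<bar> \<le> C"
proof -
  show i: "integrable M f" using b by (intro integrable_const_bound[of _ C]) auto
  have "\<bar>integral\<^sup>L M f\<bar> \<le> (\<integral>x. \<bar>f x\<bar> \<partial>M)" by (rule integral_abs_bound)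
  also have "\<dots> \<le> (\<integral>x. C \<partial>M)" using b i by (intro integral_mono_AE) auto
  finally show "\<bar>integral\<^sup>L M f\<bar> \<le> C" by (simp add: prob_space)
qed

lemma (in prob_space) bounded_integral:
  fixes f :: "'a \<Rightarrow> real"
  assumes "f \<in> borel_measurable M" and "\<And>x. x \<in> space M \<Longrightarrow> \<bar>f x\<bar> \<le> C"
  shows "integrable M f" and "\<bar>integral\<^sup>L M f\<bar> \<le> C"
  using bounded_integral_AE[of f C] assms by auto

lemma square_le_of_abs_le:
  fixes a C :: real
  assumes "\<bar>a\<bar> \<le> C"
  shows "a\<^sup>2 \<le> C\<^sup>2"
  using assms by (metis abs_ge_zero power2_abs power_mono)

text \<open>
  With \<open>m(x)\<close> and \<open>n(t)\<close> the means of \<open>g\<close> over \<open>t\<close> and over \<open>x\<close>, and \<open>M\<close> the total mean, the right side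
  minus the left side is the mean of \<open>(g - m - n + M)\<^sup>2\<close>.
\<close>
lemma pair_variance_le:
  fixes g :: "'a \<Rightarrow> 'b \<Rightarrow> real"
  assumes "prob_space P" "prob_space Q"
    and meas: "case_prod g \<in> borel_measurable (P \<Otimes>\<^sub>M Q)"
    and bdd: "\<And>x t. x \<in> space P \<Longrightarrow> t \<in> space Q \<Longrightarrow> \<bar>g x t\<bar> \<le> B"
  shows "(\<integral>x. (\<integral>t. (g x t)\<^sup>2 \<partial>Q) \<partial>P) - (\<integral>x. (\<integral>t. g x t \<partial>Q) \<partial>P)\<^sup>2
    \<le> (\<integral>t. (\<integral>x. (g x t)\<^sup>2 \<partial>P) - (\<integral>x. g x t \<partial>P)\<^sup>2 \<partial>Q)
      + (\<integral>x. (\<integral>t. (g x t)\<^sup>2 \<partial>Q) - (\<integral>t. g x t \<partial>Q)\<^sup>2 \<partial>P)"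
proof -
  interpret P: prob_space P by fact
  interpret Q: prob_space Q by fact
  interpret PQ: pair_prob_space P Q by unfold_locales
  note [measurable] = meas
  note intP = P.bounded_integral(1) and leP = P.bounded_integral(2)
  note intQ = Q.bounded_integral(1) and leQ = Q.bounded_integral(2)
  note sq = square_le_of_abs_le
  define m where "m x = (\<integral>t. g x t \<partial>Q)" for x
  define n where "n t = (\<integral>x. g x t \<partial>P)" for t
  define M where "M = (\<integral>x. m x \<partial>P)"
  have [measurable]: "m \<in> borel_measurable P" "n \<in> borel_measurable Q"
    unfolding m_def n_def by measurable
  have gP: "(\<lambda>x. g x t) \<in> borel_measurable P" if "t \<in> space Q" for t using that by measurable
  have gQ: "(\<lambda>t. g x t) \<in> borel_measurable Q" if "x \<in> space P" for x using that by measurable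
  have mb: "\<bar>m x\<bar> \<le> B" if "x \<in> space P" for x
    unfolding m_def using that bdd gQ by (intro leQ) auto
  have nb: "\<bar>n t\<bar> \<le> B" if "t \<in> space Q" for t
    unfolding n_def using that bdd gP by (intro leP) auto
  have bdd2: "\<bar>(g x t)\<^sup>2\<bar> \<le> B\<^sup>2" if "x \<in> space P" "t \<in> space Q" for x t using sq[OF bdd[OF that]] by simp
  have bddn: "\<bar>g x t * n t\<bar> \<le> B * B" if "x \<in> space P" "t \<in> space Q" for x t
    unfolding abs_mult using bdd[OF that] nb[OF that(2)] by (intro mult_mono) auto
  have fub: "(\<integral>t. (\<integral>x. h x t \<partial>P) \<partial>Q) = (\<integral>x. (\<integral>t. h x t \<partial>Q) \<partial>P)"
    if "case_prod h \<in> borel_measurable (P \<Otimes>\<^sub>M Q)" "\<And>x t. x \<in> space P \<Longrightarrow> t \<in> space Q \<Longrightarrow> \<bar>h x t\<bar> \<le> C"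
    for h :: "'a \<Rightarrow> 'b \<Rightarrow> real" and C
    using that by (intro PQ.Fubini_integral PQ.P.integrable_const_bound[of _ C]) (auto simp: space_pair_measure)
  have M: "M = (\<integral>t. n t \<partial>Q)"
    unfolding M_def m_def n_def using fub[of g B] meas bdd by simp
  define a where "a x = (\<integral>t. (g x t)\<^sup>2 \<partial>Q)" for x
  define b where "b x = (\<integral>t. g x t * n t \<partial>Q)" for x
  have [measurable]: "a \<in> borel_measurable P" "b \<in> borel_measurable P"
    unfolding a_def b_def by measurable
  have ab: "\<bar>a x\<bar> \<le> B\<^sup>2" if "x \<in> space P" for x
    unfolding a_def using that bdd2 gQ by (intro leQ) auto
  have bb: "\<bar>b x\<bar> \<le> B * B" if "x \<in> space P" for x
    unfolding b_def using that bddn gQ by (intro leQ) auto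
  have ia: "integrable P a" "integrable P b" "integrable P m" "integrable P (\<lambda>x. (m x)\<^sup>2)"
    using ab bb mb sq[OF mb] by (auto intro!: intP)
  have inn: "integrable Q n" "integrable Q (\<lambda>t. (n t)\<^sup>2)"
    using nb sq[OF nb] by (auto intro!: intQ)
  have Ib: "(\<integral>x. b x \<partial>P) = (\<integral>t. (n t)\<^sup>2 \<partial>Q)"
  proof -
    have "(\<integral>x. b x \<partial>P) = (\<integral>t. (\<integral>x. g x t * n t \<partial>P) \<partial>Q)"
      unfolding b_def by (rule fub[symmetric, OF _ bddn]) auto
    also have "\<dots> = (\<integral>t. (n t)\<^sup>2 \<partial>Q)"
      by (intro Bochner_Integration.integral_cong) (auto simp: n_def power2_eq_square)
    finally show ?thesis .
  qed
  have Ia: "(\<integral>t. (\<integral>x. (g x t)\<^sup>2 \<partial>P) \<partial>Q) = (\<integral>x. a x \<partial>P)"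
    unfolding a_def by (rule fub[OF _ bdd2]) auto
  have inner: "(\<integral>t. (g x t - n t - (m x - M))\<^sup>2 \<partial>Q) = a x - 2 * b x + (\<integral>t. (n t)\<^sup>2 \<partial>Q) - (m x - M)\<^sup>2"
    if x: "x \<in> space P" for x
  proof -
    have i: "integrable Q (\<lambda>t. (g x t)\<^sup>2)" "integrable Q (\<lambda>t. g x t * n t)" "integrable Q (\<lambda>t. g x t)"
      using x bdd2 bddn bdd gQ[OF x] by (auto intro!: intQ)
    have "(\<integral>t. (g x t - n t - (m x - M))\<^sup>2 \<partial>Q) =
      (\<integral>t. (g x t)\<^sup>2 - 2 * (g x t * n t) + (n t)\<^sup>2 - 2 * (m x - M) * g x t + 2 * (m x - M) * n t + (m x - M)\<^sup>2 \<partial>Q)"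
      by (intro Bochner_Integration.integral_cong) (auto simp: power2_eq_square algebra_simps)
    also have "\<dots> = a x - 2 * b x + (\<integral>t. (n t)\<^sup>2 \<partial>Q) - 2 * (m x - M) * m x + 2 * (m x - M) * M + (m x - M)\<^sup>2"
      using i inn by (simp add: a_def b_def m_def M Q.prob_space)
    also have "\<dots> = a x - 2 * b x + (\<integral>t. (n t)\<^sup>2 \<partial>Q) - (m x - M)\<^sup>2"
      by (simp add: power2_eq_square algebra_simps)
    finally show ?thesis .
  qed
  have "0 \<le> (\<integral>x. (\<integral>t. (g x t - n t - (m x - M))\<^sup>2 \<partial>Q) \<partial>P)" by simp
  also have "\<dots> = (\<integral>x. a x - 2 * b x + (\<integral>t. (n t)\<^sup>2 \<partial>Q) - ((m x)\<^sup>2 - 2 * M * m x + M\<^sup>2) \<partial>P)"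
    using inner by (intro Bochner_Integration.integral_cong) (auto simp: power2_eq_square algebra_simps)
  also have "\<dots> = (\<integral>x. a x \<partial>P) - (\<integral>t. (n t)\<^sup>2 \<partial>Q) - (\<integral>x. (m x)\<^sup>2 \<partial>P) + M\<^sup>2"
    using ia by (simp add: Ib M_def[symmetric] P.prob_space power2_eq_square)
  finally have main: "0 \<le> (\<integral>x. a x \<partial>P) - (\<integral>t. (n t)\<^sup>2 \<partial>Q) - (\<integral>x. (m x)\<^sup>2 \<partial>P) + M\<^sup>2" .
  have iaQ: "integrable Q (\<lambda>t. \<integral>x. (g x t)\<^sup>2 \<partial>P)"
    using bdd2 gP by (intro intQ[where C = "B\<^sup>2"] leP) auto
  show ?thesis
    using main ia inn iaQ Ia unfolding m_def[symmetric] n_def[symmetric] a_def[symmetric] M_def[symmetric]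
    by simp
qed

definition circ_var :: "nat \<Rightarrow> ((nat \<Rightarrow> real) \<Rightarrow> real) \<Rightarrow> (nat \<Rightarrow> real) \<Rightarrow> real" where
  "circ_var j f x = (\<integral>t. (f (x(j := t)))\<^sup>2 \<partial>circ) - (\<integral>t. f (x(j := t)) \<partial>circ)\<^sup>2"

lemma measurable_coordinate_update:
  assumes "j \<in> K"
  shows "(\<lambda>(x, t). x(j := t)) \<in> measurable (tor K \<Otimes>\<^sub>M circ) (tor K)"
  unfolding case_prod_beta
  by (rule measurable_fun_upd[where J = K]) (use assms in auto)

lemma circ_var_measurable_bounded:
  assumes j: "j \<in> K" and [measurable]: "f \<in> borel_measurable (tor K)"
    and b: "\<And>x. x \<in> space (tor K) \<Longrightarrow> \<bar>f x\<bar> \<le> B"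
  shows "circ_var j f \<in> borel_measurable (tor K)"
    and "x \<in> space (tor K) \<Longrightarrow> \<bar>circ_var j f x\<bar> \<le> B\<^sup>2 + B\<^sup>2"
proof -
  note [measurable] = measurable_coordinate_update[OF j]
  show "circ_var j f \<in> borel_measurable (tor K)"
    unfolding circ_var_def by measurable
next
  assume x: "x \<in> space (tor K)"
  note sq = square_le_of_abs_le
  have s: "x(j := t) \<in> space (tor K)" for t
    using x j by (auto simp: space_PiM PiE_iff extensional_def)
  note [measurable] = measurable_coordinate_update[OF j]
  have m: "(\<lambda>t. f (x(j := t))) \<in> borel_measurable circ"
    using x by measurable
  have 1: "\<bar>\<integral>t. (f (x(j := t)))\<^sup>2 \<partial>circ\<bar> \<le> B\<^sup>2"
    by (rule circ.bounded_integral) (use m sq[OF b[OF s]] in auto)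
  have 2: "(\<integral>t. f (x(j := t)) \<partial>circ)\<^sup>2 \<le> B\<^sup>2"
    by (rule sq[OF circ.bounded_integral(2)]) (use m b[OF s] in auto)
  show "\<bar>circ_var j f x\<bar> \<le> B\<^sup>2 + B\<^sup>2" 
    using 1 2 zero_le_power2[of "\<integral>t. f (x(j := t)) \<partial>circ"] zero_le_power2[of B]
    unfolding circ_var_def by linarith
qed

text \<open>
  Splitting off one coordinate with the inequality for two factors leaves the mean over that coordinate
  of the variance in the others, to which the induction hypothesis applies.
\<close>
lemma efron_stein:
  assumes "finite J" and "f \<in> borel_measurable (tor J)"
    and "\<And>x. x \<in> space (tor J) \<Longrightarrow> \<bar>f x\<bar> \<le> B"
  shows "(\<integral>x. (f x)\<^sup>2 \<partial>tor J) - (\<integral>x. f x \<partial>tor J)\<^sup>2 \<le> (\<Sum>j\<in>J. \<integral>x. circ_var j f x \<partial>tor J)"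
  using assms
proof (induction J arbitrary: f rule: finite_induct)
  case empty
  show ?case by (simp add: PiM_empty lebesgue_integral_count_space_finite)
next
  case (insert i J f)
  interpret J: prob_space "tor J" by (rule prob_space_tor)
  interpret K: prob_space "tor (insert i J)" by (rule prob_space_tor)
  note [measurable] = insert.prems(1)
  note b = insert.prems(2)
  note sq = square_le_of_abs_le
  have upd: "(\<lambda>(x, t). x(i := t)) \<in> measurable (tor J \<Otimes>\<^sub>M circ) (tor (insert i J))"
    unfolding case_prod_beta by (rule measurable_fun_upd[where J = J]) auto
  have s: "x(i := t) \<in> space (tor (insert i J))" if "x \<in> space (tor J)" for x t
    using that by (auto simp: space_PiM PiE_iff extensional_def)
  note intK = K.bounded_integral(1)
  define g where "g x t = f (x(i := t))" for x t
  have gm: "case_prod g \<in> borel_measurable (tor J \<Otimes>\<^sub>M circ)"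
    unfolding g_def using upd by measurable
  have gb: "\<bar>g x t\<bar> \<le> B" if "x \<in> space (tor J)" for x t
    unfolding g_def using b s that by blast
  have split: "(\<integral>x. h x \<partial>tor (insert i J)) = (\<integral>x. (\<integral>t. h (x(i := t)) \<partial>circ) \<partial>tor J)"
    if "integrable (tor (insert i J)) h" for h :: "_ \<Rightarrow> real"
    by (rule circ_prod.product_integral_insert[OF insert.hyps that])
  interpret JC: pair_prob_space "tor J" circ by unfold_locales
  have split': "(\<integral>x. h x \<partial>tor (insert i J)) = (\<integral>t. (\<integral>x. h (x(i := t)) \<partial>tor J) \<partial>circ)"
    if [measurable]: "h \<in> borel_measurable (tor (insert i J))"
      and hb: "\<And>x. x \<in> space (tor (insert i J)) \<Longrightarrow> \<bar>h x\<bar> \<le> C" for h :: "_ \<Rightarrow> real" and C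
  proof -
    note [measurable] = upd
    have "integrable (tor J \<Otimes>\<^sub>M circ) (\<lambda>(x, t). h (x(i := t)))"
      using hb s by (intro JC.P.integrable_const_bound[of _ C]) (auto simp: space_pair_measure)
    from JC.Fubini_integral[OF this] show ?thesis
      using hb by (subst split[OF intK]) auto
  qed
  have cv: "integrable (tor (insert i J)) (circ_var j f)" if "j \<in> insert i J" for j
    using circ_var_measurable_bounded[OF that insert.prems] by (intro intK) auto
  have i1: "integrable (tor (insert i J)) f" "integrable (tor (insert i J)) (\<lambda>x. (f x)\<^sup>2)"
    using b sq[OF b] by (auto intro!: intK)
  note jb = J.bounded_integral(2)
  have icv: "integrable circ (\<lambda>t. \<integral>x. circ_var j f (x(i := t)) \<partial>tor J)" if j: "j \<in> J" for j
  proof (rule circ.bounded_integral[of _ "B\<^sup>2 + B\<^sup>2"])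
    have [measurable]: "circ_var j f \<in> borel_measurable (tor (insert i J))"
      using j by (intro circ_var_measurable_bounded[OF _ insert.prems]) auto
    note [measurable] = upd
    show "(\<lambda>t. \<integral>x. circ_var j f (x(i := t)) \<partial>tor J) \<in> borel_measurable circ"
      by measurable
    show "\<bar>\<integral>x. circ_var j f (x(i := t)) \<partial>tor J\<bar> \<le> B\<^sup>2 + B\<^sup>2" for t
      using circ_var_measurable_bounded(2)[OF _ insert.prems, of j] s j
      by (intro jb) auto
  qed
  have "(\<integral>x. (f x)\<^sup>2 \<partial>tor (insert i J)) - (\<integral>x. f x \<partial>tor (insert i J))\<^sup>2
      = (\<integral>x. (\<integral>t. (g x t)\<^sup>2 \<partial>circ) \<partial>tor J) - (\<integral>x. (\<integral>t. g x t \<partial>circ) \<partial>tor J)\<^sup>2"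
    by (simp add: split i1 g_def)
  also have "\<dots> \<le> (\<integral>t. (\<integral>x. (g x t)\<^sup>2 \<partial>tor J) - (\<integral>x. g x t \<partial>tor J)\<^sup>2 \<partial>circ)
      + (\<integral>x. (\<integral>t. (g x t)\<^sup>2 \<partial>circ) - (\<integral>t. g x t \<partial>circ)\<^sup>2 \<partial>tor J)"
    by (rule pair_variance_le[OF prob_space_tor prob_space_circ gm gb])
  also have "(\<integral>x. (\<integral>t. (g x t)\<^sup>2 \<partial>circ) - (\<integral>t. g x t \<partial>circ)\<^sup>2 \<partial>tor J) = (\<integral>x. circ_var i f x \<partial>tor (insert i J))"
    by (subst split[OF cv]) (auto simp: circ_var_def g_def[abs_def] circ.prob_space[simplified])
  also have "(\<integral>t. (\<integral>x. (g x t)\<^sup>2 \<partial>tor J) - (\<integral>x. g x t \<partial>tor J)\<^sup>2 \<partial>circ)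
      \<le> (\<integral>t. (\<Sum>j\<in>J. \<integral>x. circ_var j f (x(i := t)) \<partial>tor J) \<partial>circ)"
  proof (rule integral_mono)
    fix t
    have gt: "(\<lambda>x. g x t) \<in> borel_measurable (tor J)" using gm by measurable
    have "(\<integral>x. (g x t)\<^sup>2 \<partial>tor J) - (\<integral>x. g x t \<partial>tor J)\<^sup>2 \<le> (\<Sum>j\<in>J. \<integral>x. circ_var j (\<lambda>x. g x t) x \<partial>tor J)"
      using insert.IH[OF gt] gb by blast
    also have "\<dots> = (\<Sum>j\<in>J. \<integral>x. circ_var j f (x(i := t)) \<partial>tor J)"
    proof (intro sum.cong Bochner_Integration.integral_cong refl)
      fix j x assume "j \<in> J"
      then have "j \<noteq> i" using insert.hyps by auto
      then show "circ_var j (\<lambda>x. g x t) x = circ_var j f (x(i := t))"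
        by (simp add: circ_var_def g_def fun_upd_twist[OF \<open>j \<noteq> i\<close>])
    qed
    finally show "(\<integral>x. (g x t)\<^sup>2 \<partial>tor J) - (\<integral>x. g x t \<partial>tor J)\<^sup>2 \<le> (\<Sum>j\<in>J. \<integral>x. circ_var j f (x(i := t)) \<partial>tor J)" .
  next
    note [measurable] = gm upd
    have "\<bar>(\<integral>x. (g x t)\<^sup>2 \<partial>tor J)\<bar> \<le> B\<^sup>2" for t
      using gb sq[OF gb] by (intro jb) auto
    moreover have "(\<integral>x. g x t \<partial>tor J)\<^sup>2 \<le> B\<^sup>2" for t
      using gb by (intro sq jb) auto
    ultimately show "integrable circ (\<lambda>t. (\<integral>x. (g x t)\<^sup>2 \<partial>tor J) - (\<integral>x. g x t \<partial>tor J)\<^sup>2)"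
      by (intro Bochner_Integration.integrable_diff circ.bounded_integral(1)[of _ "B\<^sup>2"]) auto
    show "integrable circ (\<lambda>t. \<Sum>j\<in>J. \<integral>x. circ_var j f (x(i := t)) \<partial>tor J)"
      by (intro Bochner_Integration.integrable_sum icv)
  qed
  also have "(\<integral>t. (\<Sum>j\<in>J. \<integral>x. circ_var j f (x(i := t)) \<partial>tor J) \<partial>circ)
      = (\<Sum>j\<in>J. \<integral>x. circ_var j f x \<partial>tor (insert i J))"
    by (subst Bochner_Integration.integral_sum[OF icv])
      (auto intro!: sum.cong split'[symmetric] circ_var_measurable_bounded[OF _ insert.prems])
  finally show ?case using insert.hyps by simp
qed

section \<open>Torus means of continuous functions\<close>

lemma tor_eq_density:
  assumes "finite J"
  shows "density (\<Pi>\<^sub>M j\<in>J. lborel) (\<lambda>x. \<Prod>j\<in>J. ennreal (indicator {-pi..pi} (x j) / (2 * pi))) = tor J"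
proof (rule circ_prod.PiM_eqI[OF assms])
  interpret L: product_sigma_finite "\<lambda>_::nat. lborel :: real measure" by unfold_locales
  let ?g = "\<lambda>t. ennreal (indicator {-pi..pi} t / (2 * pi)) :: ennreal"
  fix A :: "nat \<Rightarrow> real set" assume "\<And>i. i \<in> J \<Longrightarrow> A i \<in> sets circ"
  then have A: "A i \<in> sets borel" if "i \<in> J" for i using that by auto
  have "emeasure (density (\<Pi>\<^sub>M j\<in>J. lborel) (\<lambda>x. \<Prod>j\<in>J. ?g (x j))) (Pi\<^sub>E J A)
    = (\<integral>\<^sup>+x. (\<Prod>j\<in>J. ?g (x j)) * indicator (Pi\<^sub>E J A) x \<partial>(\<Pi>\<^sub>M j\<in>J. lborel))"
    using A assms by (intro emeasure_density sets_PiM_I_finite) auto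
  also have "\<dots> = (\<integral>\<^sup>+x. (\<Prod>j\<in>J. ?g (x j) * indicator (A j) (x j)) \<partial>(\<Pi>\<^sub>M j\<in>J. lborel))"
  proof (intro nn_integral_cong)
    fix x :: "nat \<Rightarrow> real" assume "x \<in> space (\<Pi>\<^sub>M j\<in>J. lborel)"
    then have x: "x \<in> extensional J" by (auto simp: space_PiM PiE_iff)
    have "(indicator (Pi\<^sub>E J A) x :: ennreal) = (\<Prod>j\<in>J. indicator (A j) (x j))"
      using x assms by (auto simp: indicator_def PiE_iff)
    then show "(\<Prod>j\<in>J. ?g (x j)) * indicator (Pi\<^sub>E J A) x = (\<Prod>j\<in>J. ?g (x j) * indicator (A j) (x j))"
      by (simp add: prod.distrib)
  qed
  also have "\<dots> = (\<Prod>j\<in>J. \<integral>\<^sup>+t. ?g t * indicator (A j) t \<partial>lborel)"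
    using A by (intro L.product_nn_integral_prod assms) auto
  also have "\<dots> = (\<Prod>j\<in>J. emeasure circ (A j))"
    unfolding circ_eq_density using A by (intro prod.cong refl) (auto simp: emeasure_density)
  finally show "emeasure (density (\<Pi>\<^sub>M j\<in>J. lborel) (\<lambda>x. \<Prod>j\<in>J. ?g (x j))) (Pi\<^sub>E J A)
    = (\<Prod>j\<in>J. emeasure circ (A j))" .
qed (unfold sets_density, intro sets_PiM_cong, auto)

abbreviation mean :: "nat \<Rightarrow> ((nat \<Rightarrow> real) \<Rightarrow> real) \<Rightarrow> real" where
  "mean d \<equiv> integral\<^sup>L (tor {..<d})"

lemma space_tor: "space (tor {..<d}) = Rn d"
  by (simp add: space_PiM Rn_def)

lemma upd_Rn: "x \<in> Rn d \<Longrightarrow> j < d \<Longrightarrow> x(j := t) \<in> Rn d"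
  by (auto simp: Rn_def PiE_iff extensional_def)

lemma torus_subset_Rn: "torus d \<subseteq> Rn d"
  by (auto simp: Rn_def torus_def PiE_iff)

lemma restrict_eq_Rn: "x \<in> Rn d \<Longrightarrow> restrict x {..<d} = x"
  by (auto simp: Rn_def PiE_iff extensional_restrict)

lemma continuous_Rn_measurable_borel:
  assumes "continuous_on (Rn d) f" and N: "sets N = sets (\<Pi>\<^sub>M j\<in>{..<d}. borel)"
  shows "f \<in> borel_measurable N"
proof -
  have spN: "space N = Rn d" using sets_eq_imp_space_eq[OF N] by (simp add: space_PiM Rn_def)
  have "continuous_on UNIV (\<lambda>y. f (restrict y {..<d}))"
  proof (rule continuous_on_compose2[OF assms(1)])
    show "continuous_on UNIV (\<lambda>y::nat \<Rightarrow> real. restrict y {..<d})"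
    proof (rule continuous_on_coordinatewise_then_product)
      fix i show "continuous_on UNIV (\<lambda>y::nat \<Rightarrow> real. restrict y {..<d} i)"
        by (cases "i < d") (auto simp: restrict_def)
    qed
    show "(\<lambda>y. restrict y {..<d}) ` UNIV \<subseteq> Rn d"
      unfolding Rn_def by (rule image_subsetI, rule restrict_PiE_iff[THEN iffD2]) simp
  qed
  then have 1: "(\<lambda>y. f (restrict y {..<d})) \<in> borel_measurable borel"
    by (rule borel_measurable_continuous_onI)
  have 2: "(\<lambda>x. x) \<in> borel_measurable N"
  proof (rule measurable_coordinatewise_then_product)
    fix i
    show "(\<lambda>x. x i) \<in> borel_measurable N"
    proof (cases "i < d")
      case True
      then have "(\<lambda>x. x i) \<in> measurable (\<Pi>\<^sub>M j\<in>{..<d}. borel) borel"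
        by (intro measurable_component_singleton) auto
      then show ?thesis using measurable_cong_sets[OF N refl] by blast
    next
      case False
      have "(\<lambda>x. x i) \<in> borel_measurable N \<longleftrightarrow> (\<lambda>x. undefined :: real) \<in> borel_measurable N"
        using False by (intro measurable_cong) (auto simp: spN Rn_def PiE_iff extensional_def)
      then show ?thesis by simp
    qed
  qed
  have "(\<lambda>x. f (restrict x {..<d})) \<in> borel_measurable N"
    using measurable_compose[OF 2 1] .
  moreover have "(\<lambda>x. f (restrict x {..<d})) \<in> borel_measurable N \<longleftrightarrow> f \<in> borel_measurable N"
    by (intro measurable_cong) (simp add: spN restrict_eq_Rn)
  ultimately show ?thesis by simp
qed

lemma compact_torus: "compact (torus d)"
proof -
  have "torus d = PiE UNIV (\<lambda>i. if i < d then {-pi..pi} else {undefined})"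
  proof (rule set_eqI)
    fix x :: "nat \<Rightarrow> real"
    have "x \<in> torus d \<longleftrightarrow> (\<forall>i. (i < d \<longrightarrow> x i \<in> {-pi..pi}) \<and> (\<not> i < d \<longrightarrow> x i = undefined))"
      unfolding torus_def PiE_iff extensional_def by blast
    then show "x \<in> torus d \<longleftrightarrow> x \<in> PiE UNIV (\<lambda>i. if i < d then {-pi..pi} else {undefined})"
      by (simp only: PiE_UNIV_domain Pi_iff split: if_split) simp
  qed
  moreover have "compactin (product_topology (\<lambda>_. euclidean) UNIV) (PiE UNIV (\<lambda>i. if i < d then {-pi..pi} else {undefined::real}))"
    unfolding compactin_PiE by (auto simp: compactin_euclidean_iff)
  ultimately show ?thesis by (simp add: euclidean_product_topology compactin_euclidean_iff)
qed

lemma continuous_Rn_bounded: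
  assumes "continuous_on (Rn d) f"
  obtains B where "\<And>x. x \<in> torus d \<Longrightarrow> \<bar>f x :: real\<bar> \<le> B" "B \<ge> 0"
proof -
  have "compact (f ` torus d)"
    using assms compact_torus continuous_on_subset torus_subset_Rn compact_continuous_image by metis
  then have "bounded (f ` torus d)" by (rule compact_imp_bounded)
  then obtain B where "\<forall>x\<in>torus d. \<bar>f x\<bar> \<le> B" unfolding bounded_iff by auto
  then have "\<bar>f x\<bar> \<le> max B 0" if "x \<in> torus d" for x
    using that by (simp add: le_max_iff_disj)
  then show ?thesis by (rule that) simp_all
qed

lemma AE_torus: "AE x in tor {..<d}. x \<in> torus d"
proof -
  have "AE x in density (\<Pi>\<^sub>M j\<in>{..<d}. lborel) (\<lambda>x. \<Prod>j\<in>{..<d}. ennreal (indicator {-pi..pi} (x j) / (2 * pi))). x \<in> torus d"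
  proof (subst AE_density, measurable, rule AE_I2, rule impI)
    fix x :: "nat \<Rightarrow> real"
    assume x: "x \<in> space (\<Pi>\<^sub>M j\<in>{..<d}. lborel)"
      and p: "0 < (\<Prod>j\<in>{..<d}. ennreal (indicator {-pi..pi} (x j) / (2 * pi)))"
    have "x j \<in> {-pi..pi}" if "j < d" for j
    proof (rule ccontr)
      assume "x j \<notin> {-pi..pi}"
      then have "ennreal (indicator {-pi..pi} (x j) / (2 * pi)) = 0" by simp
      then have z: "(\<Prod>j\<in>{..<d}. ennreal (indicator {-pi..pi} (x j) / (2 * pi))) = 0"
        using that by (intro prod_zero) auto
      show False using p by (simp only: z less_irrefl)
    qed
    then show "x \<in> torus d" using x by (simp add: space_PiM torus_def PiE_iff)
  qed
  then show ?thesis unfolding tor_eq_density[OF finite_lessThan] .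
qed

lemma AE_circ: "AE t in circ. t \<in> {-pi..pi}"
  unfolding circ_eq_density by (subst AE_density, measurable, rule AE_I2) (auto split: split_indicator)

lemma sets_tor_borel: "sets (tor {..<d}) = sets (\<Pi>\<^sub>M j\<in>{..<d}. borel)"
  by (intro sets_PiM_cong) auto

lemma continuous_Rn_measurable:
  "continuous_on (Rn d) f \<Longrightarrow> f \<in> borel_measurable (tor {..<d})"
  by (rule continuous_Rn_measurable_borel[OF _ sets_tor_borel])

lemma continuous_Rn_integrable:
  assumes "continuous_on (Rn d) f"
  shows "integrable (tor {..<d}) (f :: _ \<Rightarrow> real)"
proof -
  interpret prob_space "tor {..<d}" by (rule prob_space_tor)
  obtain B where B: "\<And>x. x \<in> torus d \<Longrightarrow> \<bar>f x\<bar> \<le> B" using continuous_Rn_bounded[OF assms] by blast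
  show ?thesis
    by (rule integrable_const_bound[of _ B])
      (use AE_torus[of d] B continuous_Rn_measurable[OF assms] in \<open>auto elim!: eventually_mono\<close>)
qed

lemma torus_integral_eq_mean:
  assumes "continuous_on (Rn d) f"
  shows "torus_integral d f = (2 * pi) ^ d * mean d f"
proof -
  let ?L = "\<Pi>\<^sub>M j\<in>{..<d}. (lborel :: real measure)"
  have [measurable]: "f \<in> borel_measurable ?L"
    by (rule continuous_Rn_measurable_borel[OF assms]) (intro sets_PiM_cong, auto)
  have "mean d f = (\<integral>x. (\<Prod>j<d. indicator {-pi..pi} (x j) / (2 * pi)) * f x \<partial>?L)"
  proof -
    have e: "(\<Prod>j<d. ennreal (indicator {-pi..pi} (x j) / (2 * pi)))
      = ennreal (\<Prod>j<d. indicator {-pi..pi} (x j) / (2 * pi))" for x :: "nat \<Rightarrow> real"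
      by (subst prod_ennreal) auto
    show ?thesis
      unfolding tor_eq_density[symmetric, OF finite_lessThan] e
      by (subst integral_density) (auto intro!: prod_nonneg)
  qed
  also have "\<dots> = (\<integral>x. (1 / (2 * pi) ^ d) * (indicator (torus d) x *\<^sub>R f x) \<partial>?L)"
  proof (intro Bochner_Integration.integral_cong refl)
    fix x assume "x \<in> space ?L"
    then have "x \<in> extensional {..<d}" by (auto simp: space_PiM PiE_iff)
    then have "(indicator (torus d) x :: real) = (\<Prod>j<d. indicator {-pi..pi} (x j))"
      by (auto simp: indicator_def torus_def PiE_iff)
    then show "(\<Prod>j<d. indicator {-pi..pi} (x j) / (2 * pi)) * f x = (1 / (2 * pi) ^ d) * (indicator (torus d) x *\<^sub>R f x)"
      by (simp add: prod_dividef)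
  qed
  also have "\<dots> = (1 / (2 * pi) ^ d) * torus_integral d f"
    unfolding torus_integral_def set_lebesgue_integral_def leb_def by (rule integral_mult_right_zero)
  finally show ?thesis by simp
qed

lemma continuous_Rn_update:
  assumes "continuous_on (Rn d) g" "x \<in> Rn d" "j < d"
  shows "continuous_on A (\<lambda>t. g (x(j := t)))"
proof (rule continuous_on_compose2[OF assms(1)])
  show "continuous_on A (\<lambda>t. x(j := t))"
  proof (rule continuous_on_coordinatewise_then_product)
    show "continuous_on A (\<lambda>t. (x(j := t)) i)" for i
      by (cases "i = j") auto
  qed
  show "(\<lambda>t. x(j := t)) ` A \<subseteq> Rn d" using assms upd_Rn by blast
qed

text \<open>
  Averaging over one coordinate first does not change the mean. This transfers statements about functions
  of a single periodic variable to the torus.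
\<close>
lemma mean_integrate_coordinate:
  assumes c: "continuous_on (Rn d) g" and j: "j < d"
  shows "mean d g = mean d (\<lambda>x. \<integral>t. g (x(j := t)) \<partial>circ)"
    and "integrable (tor {..<d}) (\<lambda>x. \<integral>t. g (x(j := t)) \<partial>circ)"
proof -
  define h where "h = (\<lambda>x. \<integral>t. g (x(j := t)) \<partial>circ)"
  interpret prob_space "tor {..<d}" by (rule prob_space_tor)
  have ins: "{..<d} = insert j ({..<d} - {j})" using j by auto
  note split = circ_prod.product_integral_insert[of "{..<d} - {j}" j, folded ins, simplified]
  have [measurable]: "(\<lambda>(x, t). x(j := t)) \<in> measurable (tor {..<d} \<Otimes>\<^sub>M circ) (tor {..<d})"
    using j by (intro measurable_coordinate_update) auto
  have [measurable]: "g \<in> borel_measurable (tor {..<d})" by (rule continuous_Rn_measurable[OF c])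
  obtain B where B: "\<And>x. x \<in> torus d \<Longrightarrow> \<bar>g x\<bar> \<le> B" using continuous_Rn_bounded[OF c] by blast
  have hm [measurable]: "h \<in> borel_measurable (tor {..<d})" unfolding h_def by measurable
  have "\<bar>h x\<bar> \<le> B" if x: "x \<in> torus d" for x
    unfolding h_def
  proof (rule circ.bounded_integral_AE)
    have "x \<in> space (tor {..<d})" using x torus_subset_Rn space_tor by blast
    then show "(\<lambda>t. g (x(j := t))) \<in> borel_measurable circ" by measurable
    have "\<bar>g (x(j := t))\<bar> \<le> B" if "t \<in> {-pi..pi}" for t
      using x j that by (intro B) (auto simp: torus_def PiE_iff extensional_def)
    then show "AE t in circ. \<bar>g (x(j := t))\<bar> \<le> B" by (rule eventually_mono[OF AE_circ])
  qed
  then have "AE x in tor {..<d}. \<bar>h x\<bar> \<le> B" using AE_torus[of d] by (auto elim!: eventually_mono)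
  then have ih: "integrable (tor {..<d}) h" by (rule bounded_integral_AE(1)[OF hm])
  have "mean d g = (\<integral>x. (\<integral>t. g (x(j := t)) \<partial>circ) \<partial>tor ({..<d} - {j}))"
    by (rule split[OF continuous_Rn_integrable[OF c]])
  also have "\<dots> = mean d h"
    by (subst split[OF ih]) (simp add: h_def circ.prob_space[simplified])
  finally show "mean d g = mean d (\<lambda>x. \<integral>t. g (x(j := t)) \<partial>circ)" by (simp add: h_def)
  show "integrable (tor {..<d}) (\<lambda>x. \<integral>t. g (x(j := t)) \<partial>circ)" using ih by (simp add: h_def)
qed

lemma mean_add:
  assumes "continuous_on (Rn d) f" "continuous_on (Rn d) g"
  shows "mean d (\<lambda>x. f x + g x) = mean d f + mean d g"
  using assms by (intro Bochner_Integration.integral_add continuous_Rn_integrable)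

lemma mean_diff:
  assumes "continuous_on (Rn d) f" "continuous_on (Rn d) g"
  shows "mean d (\<lambda>x. f x - g x) = mean d f - mean d g"
  using assms by (intro Bochner_Integration.integral_diff continuous_Rn_integrable)

lemma mean_linear:
  assumes "continuous_on (Rn d) f" "continuous_on (Rn d) g"
  shows "mean d (\<lambda>x. a * f x + b * g x) = a * mean d f + b * mean d g"
proof -
  have "mean d (\<lambda>x. a * f x + b * g x) = mean d (\<lambda>x. a * f x) + mean d (\<lambda>x. b * g x)"
    by (rule mean_add) (intro continuous_intros assms)+
  then show ?thesis by (simp only: integral_mult_right_zero)
qed

lemma mean_mono:
  assumes "continuous_on (Rn d) f" "continuous_on (Rn d) g" "\<And>x. x \<in> Rn d \<Longrightarrow> f x \<le> g x"
  shows "mean d f \<le> mean d g"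
  using assms by (intro integral_mono continuous_Rn_integrable) (auto simp: space_tor)

lemma mean_nonneg:
  assumes "\<And>x. x \<in> Rn d \<Longrightarrow> 0 \<le> f x"
  shows "0 \<le> mean d f"
  using assms by (intro Bochner_Integration.integral_nonneg) (auto simp: space_tor)

lemma measure_tor_space [simp]: "measure (tor J) (space (tor J)) = 1"
  by (rule prob_space.prob_space[OF prob_space_tor])

lemma mean_const: "mean d (\<lambda>x. a) = a"
  by simp

lemma mean_cong: "(\<And>x. x \<in> Rn d \<Longrightarrow> f x = g x) \<Longrightarrow> mean d f = mean d g"
  by (intro Bochner_Integration.integral_cong) (auto simp: space_tor)

lemma mean_Cauchy_Schwarz:
  assumes c: "continuous_on (Rn d) f" "continuous_on (Rn d) g"
  shows "(mean d (\<lambda>x. f x * g x))\<^sup>2 \<le> mean d (\<lambda>x. (f x)\<^sup>2) * mean d (\<lambda>x. (g x)\<^sup>2)"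
proof -
  define A B C where "A = mean d (\<lambda>x. (f x)\<^sup>2)" and "B = mean d (\<lambda>x. f x * g x)" and "C = mean d (\<lambda>x. (g x)\<^sup>2)"
  have i: "integrable (tor {..<d}) (\<lambda>x. (f x)\<^sup>2)" "integrable (tor {..<d}) (\<lambda>x. f x * g x)"
    "integrable (tor {..<d}) (\<lambda>x. (g x)\<^sup>2)"
    by (intro continuous_Rn_integrable continuous_intros c)+
  have q: "0 \<le> A + (C * t * t - 2 * t * B)" for t
  proof -
    have "0 \<le> mean d (\<lambda>x. (f x - t * g x)\<^sup>2)" by (rule mean_nonneg) simp
    also have "\<dots> = mean d (\<lambda>x. (f x)\<^sup>2 + ((g x)\<^sup>2 * (t * t) - (f x * g x) * (2 * t)))"
      by (rule mean_cong) (simp add: power2_eq_square algebra_simps)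
    also have "\<dots> = A + (C * (t * t) - B * (2 * t))"
      by (simp add: i A_def B_def C_def)
    finally show ?thesis by (simp add: mult.commute mult.left_commute mult.assoc)
  qed
  have C0: "0 \<le> C" unfolding C_def by (rule mean_nonneg) simp
  have "B\<^sup>2 \<le> A * C"
  proof (cases "C = 0")
    case True
    have "B = 0"
    proof (rule ccontr)
      assume B: "B \<noteq> 0"
      have "0 \<le> A - 2 * ((A + 1) / (2 * B)) * B" using q[of "(A + 1) / (2 * B)"] True by simp
      then show False using B by simp
    qed
    then show ?thesis using True by simp
  next
    case False
    then have "C > 0" using C0 by simp
    then show ?thesis using q[of "B / C"] by (simp add: field_simps power2_eq_square)
  qed
  then show ?thesis by (simp add: A_def B_def C_def)
qed

section \<open>Periodic partial derivatives\<close>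

text \<open>
  The domain of the calculus below: \<open>G\<close> is the continuous \<open>j\<close>-th partial derivative of the
  continuous function \<open>F\<close>, which is periodic in the \<open>j\<close>-th variable. Carrying the derivative along as an
  argument lets products and compositions be differentiated by matching rules. Periodicity is
  asked for in direction \<open>j\<close> only, since this is what integration by parts in that direction consumes.
\<close>
definition periodic_partial :: "nat \<Rightarrow> nat \<Rightarrow> ((nat \<Rightarrow> real) \<Rightarrow> real) \<Rightarrow> ((nat \<Rightarrow> real) \<Rightarrow> real) \<Rightarrow> bool" where
  "periodic_partial d j F G \<longleftrightarrow> continuous_on (Rn d) F \<and> continuous_on (Rn d) G \<and>
     (\<forall>x\<in>Rn d. ((\<lambda>t. F (x(j := t))) has_real_derivative G x) (at (x j))) \<and>
     (\<forall>x\<in>Rn d. F (x(j := x j + 2 * pi)) = F x)"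

lemma periodic_partialD:
  assumes "periodic_partial d j F G" "x \<in> Rn d" "j < d"
  shows "((\<lambda>t. F (x(j := t))) has_real_derivative G (x(j := s))) (at s)"
    and "F (x(j := pi)) = F (x(j := -pi))"
proof -
  have x: "x(j := t) \<in> Rn d" for t using assms upd_Rn by blast
  show "((\<lambda>t. F (x(j := t))) has_real_derivative G (x(j := s))) (at s)"
    using assms(1) x[of s] unfolding periodic_partial_def by fastforce
  have "F ((x(j := -pi))(j := (x(j := -pi)) j + 2 * pi)) = F (x(j := -pi))"
    using assms(1) x[of "-pi"] unfolding periodic_partial_def by blast
  then show "F (x(j := pi)) = F (x(j := -pi))" by simp
qed

text \<open>
  Integration by parts on the torus, in the form that a total derivative has mean zero.
\<close>
lemma mean_partial_eq_0:
  assumes F: "periodic_partial d j F G" and j: "j < d"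
  shows "mean d G = 0"
proof -
  have cG: "continuous_on (Rn d) G" using F by (simp add: periodic_partial_def)
  have "(\<integral>t. G (x(j := t)) \<partial>circ) = 0" if x: "x \<in> Rn d" for x
  proof -
    have cc: "continuous_on A (\<lambda>t. G (x(j := t)))" for A
      by (rule continuous_Rn_update[OF cG x j])
    have "((\<lambda>t. G (x(j := t))) has_integral (F (x(j := pi)) - F (x(j := -pi)))) {-pi..pi}"
    proof (rule fundamental_theorem_of_calculus)
      show "((\<lambda>t. F (x(j := t))) has_vector_derivative G (x(j := s))) (at s within {-pi..pi})" for s
        by (rule has_vector_derivative_at_within)
          (rule periodic_partialD(1)[OF F x j, of s, unfolded has_real_derivative_iff_has_vector_derivative])
      show "-pi \<le> pi" by simp
    qed
    then have "integral {-pi..pi} (\<lambda>t. G (x(j := t))) = 0"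
      using periodic_partialD(2)[OF F x j] by (simp add: integral_unique)
    then show ?thesis
      by (subst integral_circ) (auto intro!: cc borel_measurable_continuous_onI)
  qed
  then have "mean d (\<lambda>x. \<integral>t. G (x(j := t)) \<partial>circ) = 0"
    by (intro Bochner_Integration.integral_eq_zero_AE, intro AE_I2) (simp add: space_tor)
  then show ?thesis using mean_integrate_coordinate[OF cG j] by simp
qed

lemma continuous_on_coord [continuous_intros]: "continuous_on A (\<lambda>x::nat \<Rightarrow> real. x i)"
  by (rule continuous_on_subset[OF continuous_on_product_coordinates]) simp

lemma periodic_partial_mult:
  assumes "periodic_partial d j F G" "periodic_partial d j F' G'"
  shows "periodic_partial d j (\<lambda>x. F x * F' x) (\<lambda>x. G x * F' x + F x * G' x)"
proof -
  have "((\<lambda>t. F (x(j := t)) * F' (x(j := t))) has_real_derivative G x * F' x + F x * G' x) (at (x j))"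
    if x: "x \<in> Rn d" for x
  proof -
    have 1: "((\<lambda>t. F (x(j := t))) has_real_derivative G x) (at (x j))"
      and 2: "((\<lambda>t. F' (x(j := t))) has_real_derivative G' x) (at (x j))"
      using assms x by (auto simp: periodic_partial_def)
    from DERIV_mult[OF 1 2] show ?thesis by (simp add: mult.commute)
  qed
  moreover have "continuous_on (Rn d) (\<lambda>x. F x * F' x)" "continuous_on (Rn d) (\<lambda>x. G x * F' x + F x * G' x)"
    using assms unfolding periodic_partial_def by (auto intro!: continuous_intros)
  ultimately show ?thesis using assms unfolding periodic_partial_def by simp
qed

lemma periodic_partial_compose:
  assumes F: "periodic_partial d j F G"
    and u: "\<And>x. x \<in> Rn d \<Longrightarrow> (u has_real_derivative u' (F x)) (at (F x))"
    and c: "continuous_on (Rn d) (\<lambda>x. u' (F x))"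
  shows "periodic_partial d j (\<lambda>x. u (F x)) (\<lambda>x. u' (F x) * G x)"
proof -
  have cF: "continuous_on (Rn d) F" and cG: "continuous_on (Rn d) G"
    using F by (auto simp: periodic_partial_def)
  have "continuous_on (F ` Rn d) u"
    by (rule continuous_at_imp_continuous_on) (use u DERIV_isCont in auto)
  then have "continuous_on (Rn d) (\<lambda>x. u (F x))"
    using cF by (rule continuous_on_compose2) auto
  moreover have "continuous_on (Rn d) (\<lambda>x. u' (F x) * G x)"
    by (intro continuous_intros c cG)
  moreover have "((\<lambda>t. u (F (x(j := t)))) has_real_derivative u' (F x) * G x) (at (x j))"
    if x: "x \<in> Rn d" for x
  proof -
    have 1: "((\<lambda>t. F (x(j := t))) has_real_derivative G x) (at (x j))"
      using F x by (auto simp: periodic_partial_def)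
    have 2: "(u has_real_derivative u' (F x)) (at ((\<lambda>t. F (x(j := t))) (x j)))"
      using u[OF x] by simp
    show ?thesis using DERIV_chain2[OF 2 1] .
  qed
  ultimately show ?thesis using F unfolding periodic_partial_def by simp
qed

lemma periodic_partial_coordinate:
  assumes "\<And>t. (u has_real_derivative u' t) (at t)" "continuous_on UNIV u'"
    and "\<And>t. u (t + 2 * pi) = u t"
  shows "periodic_partial d j (\<lambda>x. u (x j)) (\<lambda>x. u' (x j))"
proof -
  have "continuous_on UNIV u"
    by (rule continuous_at_imp_continuous_on) (use assms(1) DERIV_isCont in auto)
  then have "continuous_on (Rn d) (\<lambda>x. u (x j))"
    by (rule continuous_on_compose2) (simp_all add: continuous_on_coord)
  moreover have "continuous_on (Rn d) (\<lambda>x. u' (x j))"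
    by (rule continuous_on_compose2[OF assms(2)]) (simp_all add: continuous_on_coord)
  ultimately show ?thesis using assms unfolding periodic_partial_def by simp
qed

lemma continuous_weight: "continuous_on A (weight d)"
  unfolding weight_def[abs_def] by (intro continuous_intros) simp

lemma periodic_partial_weight:
  assumes j: "j < d"
  shows "periodic_partial d j (weight d) (\<lambda>x. sin (x j) / 2)"
proof -
  have w: "weight d (x(j := t)) = (sin (t / 2))\<^sup>2 + (\<Sum>i\<in>{..<d} - {j}. (sin (x i / 2))\<^sup>2)" for x t
    unfolding weight_def using j by (subst sum.remove[of _ j]) (auto intro!: sum.cong)
  have w0: "weight d x = (sin (x j / 2))\<^sup>2 + (\<Sum>i\<in>{..<d} - {j}. (sin (x i / 2))\<^sup>2)" for x
    using w[of x "x j"] by simp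
  have der: "((\<lambda>t. weight d (x(j := t))) has_real_derivative sin (x j) / 2) (at (x j))" for x
  proof -
    have "((\<lambda>t. weight d (x(j := t))) has_real_derivative sin (x j / 2) * cos (x j / 2)) (at (x j))"
      unfolding w by (auto intro!: derivative_eq_intros)
    moreover have "sin (x j / 2) * cos (x j / 2) = sin (x j) / 2"
      using sin_double[of "x j / 2"] by simp
    ultimately show ?thesis by simp
  qed
  have per: "weight d (x(j := x j + 2 * pi)) = weight d x" for x
  proof -
    have "sin ((x j + 2 * pi) / 2) = - sin (x j / 2)"
      by (simp add: add_divide_distrib)
    then show ?thesis unfolding w w0[of x] by simp
  qed
  have "continuous_on (Rn d) (\<lambda>x. sin (x j) / 2)" by (intro continuous_intros) auto
  then show ?thesis unfolding periodic_partial_def using der per continuous_weight by blast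
qed

section \<open>The Poincare inequality on the torus\<close>

lemma circ_var_le:
  assumes F: "periodic_partial d j F G" and j: "j < d" and x: "x \<in> Rn d"
  shows "circ_var j F x \<le> (\<integral>t. (G (x(j := t)))\<^sup>2 \<partial>circ)"
proof -
  have c: "continuous_on A (\<lambda>t. F (x(j := t)))" "continuous_on A (\<lambda>t. G (x(j := t)))" for A
    using F by (auto intro!: continuous_Rn_update[OF _ x j] simp: periodic_partial_def)
  have c2: "continuous_on A (\<lambda>t. (F (x(j := t)))\<^sup>2)" "continuous_on A (\<lambda>t. (G (x(j := t)))\<^sup>2)" for A
    by (intro continuous_intros c)+
  have "integral {-pi..pi} (\<lambda>t. (F (x(j := t)))\<^sup>2) - (integral {-pi..pi} (\<lambda>t. F (x(j := t))))\<^sup>2 / (2 * pi)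
     \<le> integral {-pi..pi} (\<lambda>t. (G (x(j := t)))\<^sup>2)"
    by (rule wirtinger) (use periodic_partialD[OF F x j] c in auto)
  then have "(integral {-pi..pi} (\<lambda>t. (F (x(j := t)))\<^sup>2) - (integral {-pi..pi} (\<lambda>t. F (x(j := t))))\<^sup>2 / (2 * pi)) / (2 * pi)
     \<le> integral {-pi..pi} (\<lambda>t. (G (x(j := t)))\<^sup>2) / (2 * pi)"
    by (rule divide_right_mono) simp
  then show ?thesis
    unfolding circ_var_def using c c2
    by (simp add: integral_circ borel_measurable_continuous_onI diff_divide_distrib power_divide power2_eq_square)
qed

text \<open>
  Efron-Stein bounds the variance by the coordinate variances, and Wirtinger's inequality bounds each of
  those. Efron-Stein is applied to \<open>F\<close> cut off outside the torus, because it asks for a bound on the whole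
  product space.
\<close>
lemma torus_poincare:
  assumes "\<And>j. j < d \<Longrightarrow> periodic_partial d j F (G j)" and cF: "continuous_on (Rn d) F"
  shows "mean d (\<lambda>x. (F x)\<^sup>2) - (mean d F)\<^sup>2 \<le> mean d (\<lambda>x. \<Sum>j<d. (G j x)\<^sup>2)"
proof -
  interpret prob_space "tor {..<d}" by (rule prob_space_tor)
  define F' where "F' x = indicator (torus d) x * F x" for x
  have tm [measurable]: "torus d \<in> sets (tor {..<d})"
    unfolding torus_def by (intro sets_PiM_I_finite) auto
  have [measurable]: "F \<in> borel_measurable (tor {..<d})" by (rule continuous_Rn_measurable[OF cF])
  have F'm [measurable]: "F' \<in> borel_measurable (tor {..<d})" unfolding F'_def by measurable
  obtain B where B: "\<And>x. x \<in> torus d \<Longrightarrow> \<bar>F x\<bar> \<le> B" "B \<ge> 0" using continuous_Rn_bounded[OF cF] by blast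
  have F'b: "\<bar>F' x\<bar> \<le> B" for x using B unfolding F'_def by (auto split: split_indicator)
  have eq: "AE x in tor {..<d}. F' x = F x"
    using AE_torus[of d] by (auto simp: F'_def elim!: eventually_mono)
  have "mean d (\<lambda>x. (F x)\<^sup>2) - (mean d F)\<^sup>2 = mean d (\<lambda>x. (F' x)\<^sup>2) - (mean d F')\<^sup>2"
  proof -
    have "mean d (\<lambda>x. (F x)\<^sup>2) = mean d (\<lambda>x. (F' x)\<^sup>2)"
      using eq by (intro integral_cong_AE) (auto elim!: eventually_mono)
    moreover have "mean d F = mean d F'"
      using eq by (intro integral_cong_AE) (auto elim!: eventually_mono)
    ultimately show ?thesis by simp
  qed
  also have "\<dots> \<le> (\<Sum>j<d. mean d (circ_var j F'))"
    by (rule efron_stein[OF _ F'm]) (use F'b in auto)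
  also have "\<dots> \<le> (\<Sum>j<d. mean d (\<lambda>x. (G j x)\<^sup>2))"
  proof (rule sum_mono)
    fix j assume "j \<in> {..<d}" then have j: "j < d" by simp
    note F = assms(1)[OF j]
    have cG: "continuous_on (Rn d) (\<lambda>x. (G j x)\<^sup>2)"
      using F by (auto simp: periodic_partial_def intro!: continuous_intros)
    have le: "circ_var j F' x \<le> (\<integral>t. (G j (x(j := t)))\<^sup>2 \<partial>circ)" if x: "x \<in> torus d" for x
    proof -
      have xR: "x \<in> Rn d" using x torus_subset_Rn by blast
      have c: "(\<lambda>t. F (x(j := t))) \<in> borel_measurable circ"
        by (subst measurable_cong_sets[OF sets_circ refl])
          (intro borel_measurable_continuous_onI continuous_Rn_update[OF cF xR j])
      have c': "(\<lambda>t. F' (x(j := t))) \<in> borel_measurable circ"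
      proof -
        note [measurable] = measurable_coordinate_update[of j "{..<d}"]
        show ?thesis using xR j by (simp add: space_tor[symmetric]) measurable
      qed
      have "F' (x(j := t)) = F (x(j := t))" if "t \<in> {-pi..pi}" for t
        using that x j by (auto simp: F'_def torus_def PiE_iff extensional_def indicator_def)
      then have ae: "AE t in circ. F' (x(j := t)) = F (x(j := t))"
        by (rule eventually_mono[OF AE_circ])
      have "circ_var j F' x = circ_var j F x"
      proof -
        have "(\<integral>t. (F' (x(j := t)))\<^sup>2 \<partial>circ) = (\<integral>t. (F (x(j := t)))\<^sup>2 \<partial>circ)"
          using ae c c' by (intro integral_cong_AE) (auto elim!: eventually_mono)
        moreover have "(\<integral>t. F' (x(j := t)) \<partial>circ) = (\<integral>t. F (x(j := t)) \<partial>circ)"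
          using ae c c' by (intro integral_cong_AE) (auto elim!: eventually_mono)
        ultimately show ?thesis by (simp add: circ_var_def)
      qed
      also have "\<dots> \<le> (\<integral>t. (G j (x(j := t)))\<^sup>2 \<partial>circ)" by (rule circ_var_le[OF F j xR])
      finally show ?thesis .
    qed
    have "mean d (circ_var j F') \<le> mean d (\<lambda>x. \<integral>t. (G j (x(j := t)))\<^sup>2 \<partial>circ)"
    proof (rule integral_mono_AE)
      show "integrable (tor {..<d}) (circ_var j F')"
        using circ_var_measurable_bounded[OF _ F'm F'b, of j] j by (intro bounded_integral) auto
      show "integrable (tor {..<d}) (\<lambda>x. \<integral>t. (G j (x(j := t)))\<^sup>2 \<partial>circ)"
        by (rule mean_integrate_coordinate[OF cG j])
      show "AE x in tor {..<d}. circ_var j F' x \<le> (\<integral>t. (G j (x(j := t)))\<^sup>2 \<partial>circ)"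
        using AE_torus[of d] le by (auto elim!: eventually_mono)
    qed
    also have "\<dots> = mean d (\<lambda>x. (G j x)\<^sup>2)"
      by (rule mean_integrate_coordinate(1)[OF cG j, symmetric])
    finally show "mean d (circ_var j F') \<le> mean d (\<lambda>x. (G j x)\<^sup>2)" .
  qed
  also have "\<dots> = mean d (\<lambda>x. \<Sum>j<d. (G j x)\<^sup>2)"
    by (rule Bochner_Integration.integral_sum[symmetric], rule continuous_Rn_integrable)
      (use assms(1) in \<open>auto simp: periodic_partial_def intro!: continuous_intros\<close>)
  finally show ?thesis .
qed

section \<open>The regularised weight\<close>

text \<open>
  The shift by \<open>\<delta>\<close> makes \<open>h\<close> positive, so that all its powers are smooth, and preserves the two facts on
  which the argument rests: \<open>\<Delta>h = c - h\<close> and \<open>R = |\<nabla>h|\<^sup>2 \<le> h\<close>. The vector field \<open>w\<close> is \<open>\<nabla>h\<close>.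
\<close>
locale regularised_weight =
  fixes d :: nat and \<delta> :: real
  assumes d1: "d \<ge> 1" and \<delta>0: "\<delta> > 0"
begin

definition h :: "(nat \<Rightarrow> real) \<Rightarrow> real" where "h x = weight d x + \<delta>"
definition c :: real where "c = real d / 2 + \<delta>"
definition w :: "nat \<Rightarrow> (nat \<Rightarrow> real) \<Rightarrow> real" where "w j x = sin (x j) / 2"
definition R :: "(nat \<Rightarrow> real) \<Rightarrow> real" where "R x = (\<Sum>j<d. (w j x)\<^sup>2)"

lemma h_pos [simp]: "h x > 0"
  unfolding h_def weight_def using \<delta>0 by (intro add_nonneg_pos sum_nonneg) auto

lemma h_nz [simp]: "h x \<noteq> 0"
  using h_pos[of x] by linarith

lemma c_pos: "c > 0" and c_ge: "real d / 2 \<le> c"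
  using d1 \<delta>0 by (auto simp: c_def)

lemma R_nonneg: "0 \<le> R x"
  unfolding R_def by (intro sum_nonneg) auto

text \<open>
  Since \<open>sin t / 2 = sin (t/2) cos (t/2)\<close>.
\<close>
lemma R_le: "R x \<le> h x"
proof -
  have "(sin t / 2)\<^sup>2 \<le> (sin (t / 2))\<^sup>2" for t :: real
  proof -
    have "(sin t / 2)\<^sup>2 = (sin (t / 2))\<^sup>2 * (cos (t / 2))\<^sup>2"
      using sin_double[of "t / 2"] by (simp add: power_mult_distrib power_divide)
    also have "\<dots> \<le> (sin (t / 2))\<^sup>2 * 1"
      by (intro mult_left_mono) (auto simp: abs_square_le_1)
    finally show ?thesis by simp
  qed
  then have "R x \<le> weight d x" unfolding R_def weight_def w_def by (intro sum_mono) auto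
  then show ?thesis using \<delta>0 by (simp add: h_def)
qed

lemma continuous_h [continuous_intros]: "continuous_on A h"
  unfolding h_def[abs_def] by (intro continuous_intros continuous_weight)

lemma continuous_w [continuous_intros]: "continuous_on A (w j)"
  unfolding w_def[abs_def] by (intro continuous_intros) auto

lemma continuous_R [continuous_intros]: "continuous_on A R"
  unfolding R_def[abs_def] by (intro continuous_intros)

lemma partial_h:
  assumes "j < d"
  shows "periodic_partial d j h (w j)"
proof -
  have "((\<lambda>t. t + \<delta>) has_real_derivative 1) (at t)" for t by (auto intro!: derivative_eq_intros)
  from periodic_partial_compose[OF periodic_partial_weight[OF assms] this] show ?thesis
    unfolding h_def[abs_def] w_def[abs_def] by simp
qed

text \<open>
  This is \<open>E(F \<Delta>h) = - E(\<nabla>F \<cdot> \<nabla>h)\<close> with \<open>\<Delta>h = c - h\<close>.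
\<close>
lemma green:
  assumes F: "\<And>j. j < d \<Longrightarrow> periodic_partial d j F (G j)"
  shows "c * mean d F = mean d (\<lambda>x. F x * h x) - mean d (\<lambda>x. \<Sum>j<d. G j x * w j x)"
proof -
  have cF: "continuous_on (Rn d) F" using F[of 0] d1 by (simp add: periodic_partial_def)
  have cG: "continuous_on (Rn d) (G j)" if "j < d" for j using F[OF that] by (simp add: periodic_partial_def)
  have w: "periodic_partial d j (w j) (\<lambda>x. cos (x j) / 2)" for j
    unfolding w_def[abs_def]
    by (rule periodic_partial_coordinate) (auto intro!: derivative_eq_intros continuous_intros)
  have "0 = (\<Sum>j<d. mean d (\<lambda>x. G j x * w j x + F x * (cos (x j) / 2)))"
    using mean_partial_eq_0[OF periodic_partial_mult[OF F w]] by simp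
  also have "\<dots> = mean d (\<lambda>x. \<Sum>j<d. G j x * w j x + F x * (cos (x j) / 2))"
    by (rule Bochner_Integration.integral_sum[symmetric], rule continuous_Rn_integrable)
      (auto intro!: continuous_intros cF cG)
  also have "\<dots> = mean d (\<lambda>x. (\<Sum>j<d. G j x * w j x) + (F x * c - F x * h x))"
  proof (rule mean_cong)
    fix x :: "nat \<Rightarrow> real"
    have "cos t / 2 = 1 / 2 - (sin (t / 2))\<^sup>2" for t :: real
      using cos_double_sin[of "t / 2"] by (simp add: field_simps)
    then have "(\<Sum>j<d. cos (x j) / 2) = (\<Sum>j<d. 1 / 2 - (sin (x j / 2))\<^sup>2)" by (simp only:)
    also have "\<dots> = c - h x" by (simp add: sum_subtractf c_def h_def weight_def)
    finally have "(\<Sum>j<d. F x * (cos (x j) / 2)) = F x * (c - h x)" by (simp only: sum_distrib_left[symmetric])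
    then show "(\<Sum>j<d. G j x * w j x + F x * (cos (x j) / 2)) = (\<Sum>j<d. G j x * w j x) + (F x * c - F x * h x)"
      by (simp add: sum.distrib right_diff_distrib)
  qed
  also have "\<dots> = mean d (\<lambda>x. \<Sum>j<d. G j x * w j x) + (mean d F * c - mean d (\<lambda>x. F x * h x))"
    by (subst mean_add, (auto intro!: continuous_intros cF cG)[2], subst mean_diff, (auto intro!: continuous_intros cF cG)[2]) simp
  finally show ?thesis by (simp add: mult.commute)
qed

lemma partial_compose_h:
  assumes "\<And>y. y > 0 \<Longrightarrow> (u has_real_derivative u' y) (at y)" "continuous_on {0<..} u'" "j < d"
  shows "periodic_partial d j (\<lambda>x. u (h x)) (\<lambda>x. u' (h x) * w j x)"
proof (rule periodic_partial_compose[where u = u and u' = u', OF partial_h[OF assms(3)]])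
  show "(u has_real_derivative u' (h x)) (at (h x))" for x by (rule assms(1)[OF h_pos])
  show "continuous_on (Rn d) (\<lambda>x. u' (h x))"
    by (rule continuous_on_compose2[OF assms(2)]) (auto intro!: continuous_intros)
qed

text \<open>
  Green's identity with \<open>F = h\<^sup>-\<^sup>j\<^sup>-\<^sup>1\<close>, followed by \<open>R \<le> h\<close>. For \<open>j + 1 < c\<close> the last term can be absorbed
  on the left, which controls each negative moment by the preceding one.
\<close>
lemma negative_moment_step:
  "c * mean d (\<lambda>x. 1 / h x ^ Suc j) \<le> mean d (\<lambda>x. 1 / h x ^ j) + real (Suc j) * mean d (\<lambda>x. 1 / h x ^ Suc j)"
proof -
  have der: "((\<lambda>y. 1 / y ^ Suc j) has_real_derivative - (real (Suc j) / y ^ Suc (Suc j))) (at y)" if "y > 0" for y :: real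
  proof -
    have "((\<lambda>y. y ^ Suc j) has_real_derivative real (Suc j) * y ^ j) (at y)"
      using DERIV_pow[of "Suc j" y] by simp
    from DERIV_inverse_fun[OF this] that
    have "((\<lambda>y. 1 / y ^ Suc j) has_real_derivative
        - (real (Suc j) * y ^ j * inverse ((y ^ Suc j) ^ Suc (Suc 0)))) (at y)"
      by (simp add: inverse_eq_divide)
    moreover have "real (Suc j) * y ^ j * inverse ((y ^ Suc j) ^ Suc (Suc 0)) = real (Suc j) / y ^ Suc (Suc j)"
      using that by (simp add: divide_simps)
    ultimately show ?thesis by simp
  qed
  have cder: "continuous_on {0<..} (\<lambda>y::real. - (real (Suc j) / y ^ Suc (Suc j)))"
    by (intro continuous_intros) auto
  have "periodic_partial d i (\<lambda>x. 1 / h x ^ Suc j) (\<lambda>x. - (real (Suc j) / h x ^ Suc (Suc j)) * w i x)" if "i < d" for i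
    by (rule partial_compose_h[OF der cder that])
  from green[OF this]
  have eq: "c * mean d (\<lambda>x. 1 / h x ^ Suc j) = mean d (\<lambda>x. 1 / h x ^ Suc j * h x)
    - mean d (\<lambda>x. \<Sum>i<d. - (real (Suc j) / h x ^ Suc (Suc j)) * w i x * w i x)" .
  have "mean d (\<lambda>x. 1 / h x ^ Suc j * h x) = mean d (\<lambda>x. 1 / h x ^ j)"
    by (rule mean_cong) simp
  moreover have "mean d (\<lambda>x. \<Sum>i<d. - (real (Suc j) / h x ^ Suc (Suc j)) * w i x * w i x)
    = mean d (\<lambda>x. R x / h x ^ Suc (Suc j) * (- real (Suc j)))"
  (is "_ = ?r") proof (rule mean_cong)
    fix x
    have e: "(\<Sum>i<d. - a * w i x * w i x) = - a * R x" for a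
      by (simp add: R_def sum_distrib_left power2_eq_square mult.assoc)
    show "(\<Sum>i<d. - (real (Suc j) / h x ^ Suc (Suc j)) * w i x * w i x) = R x / h x ^ Suc (Suc j) * - real (Suc j)"
      unfolding e by (simp add: divide_inverse ac_simps del: of_nat_Suc)
  qed
  moreover have "?r = mean d (\<lambda>x. R x / h x ^ Suc (Suc j)) * (- real (Suc j))"
    by (rule integral_mult_left_zero)
  moreover have "real (Suc j) * mean d (\<lambda>x. R x / h x ^ Suc (Suc j)) \<le> real (Suc j) * mean d (\<lambda>x. 1 / h x ^ Suc j)"
  proof (rule mult_left_mono[OF mean_mono])
    fix x
    have "R x / h x ^ Suc (Suc j) \<le> h x / h x ^ Suc (Suc j)"
      using R_le[of x] by (rule divide_right_mono) (simp add: less_imp_le)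
    then show "R x / h x ^ Suc (Suc j) \<le> 1 / h x ^ Suc j" by simp
  qed (auto intro!: continuous_intros)
  ultimately show ?thesis using eq by (simp add: mult.commute del: of_nat_Suc power_Suc)
qed

lemma negative_moment_le:
  assumes K: "2 * real K < real d" and "j \<le> K"
  shows "c ^ j * mean d (\<lambda>x. 1 / h x ^ j) \<le> 1 / (1 - 2 * real K / real d) ^ j"
  using \<open>j \<le> K\<close>
proof (induction j)
  case 0
  show ?case by (simp add: mean_const)
next
  case (Suc j)
  define q where "q = 1 - 2 * real K / real d"
  define M where "M = mean d (\<lambda>x. 1 / h x ^ Suc j)"
  have q: "q > 0" using K d1 by (simp add: q_def)
  have M: "M \<ge> 0" unfolding M_def by (intro mean_nonneg divide_nonneg_nonneg zero_le_power) (auto intro: less_imp_le)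
  have "real (Suc j) \<le> real K" using Suc.prems by simp
  also have "\<dots> = (real d / 2) * (2 * real K / real d)" using d1 by simp
  also have "\<dots> \<le> c * (2 * real K / real d)" using c_ge by (intro mult_right_mono) auto
  finally have "c * q \<le> c - real (Suc j)" unfolding q_def by (simp add: right_diff_distrib)
  then have "c * q * M \<le> (c - real (Suc j)) * M" using M by (rule mult_right_mono)
  also have "\<dots> \<le> mean d (\<lambda>x. 1 / h x ^ j)"
    using negative_moment_step[of j] unfolding M_def by (simp add: left_diff_distrib)
  finally have "c ^ j * (c * q * M) \<le> c ^ j * mean d (\<lambda>x. 1 / h x ^ j)"
    using c_pos by (intro mult_left_mono) auto
  also have "\<dots> \<le> 1 / q ^ j" using Suc unfolding q_def by simp
  finally have "c ^ Suc j * M * q \<le> 1 / q ^ j" by (simp add: mult_ac)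
  then have "c ^ Suc j * M \<le> 1 / q ^ j / q" by (simp only: pos_le_divide_eq[OF q])
  then show ?case unfolding M_def q_def by (simp add: mult.commute)
qed

lemma mean_h: "mean d h = c"
proof -
  have "periodic_partial d j (\<lambda>_. 1) (\<lambda>_. 0)" for j by (simp add: periodic_partial_def)
  from green[OF this] show ?thesis by (simp add: mean_const)
qed

text \<open>
  Bernoulli's inequality bounds \<open>(c/h)\<^sup>k\<close> below by \<open>1 + k (c/h - 1) \<ge> 1 + k (1 - h/c)\<close>, and \<open>h\<close> has mean \<open>c\<close>.
\<close>
lemma mean_inverse_power_ge: "1 \<le> mean d (\<lambda>x. c ^ k / h x ^ k)"
proof -
  have "1 = mean d (\<lambda>x. 1 + real k * (1 - h x / c))"
  proof -
    have "integrable (tor {..<d}) h" by (intro continuous_Rn_integrable continuous_intros)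
    moreover have "integrable (tor {..<d}) (\<lambda>x. a)" for a :: real
      by (intro continuous_Rn_integrable continuous_intros)
    ultimately show ?thesis using c_pos by (simp add: mean_const mean_h)
  qed
  also have "\<dots> \<le> mean d (\<lambda>x. c ^ k / h x ^ k)"
  proof (rule mean_mono)
    fix x
    define z where "z = c / h x"
    have z: "z > 0" using c_pos by (simp add: z_def)
    have "0 \<le> (z - 1)\<^sup>2 / z" using z by simp
    also have "\<dots> = z - 1 - (1 - 1 / z)" using z by (simp add: power2_eq_square field_simps)
    finally have "1 - 1 / z \<le> z - 1" by simp
    then have "1 + real k * (1 - 1 / z) \<le> 1 + real k * (z - 1)" by (intro add_left_mono mult_left_mono) auto
    also have "\<dots> \<le> (1 + (z - 1)) ^ k" using z by (intro Bernoulli_inequality) simp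
    finally show "1 + real k * (1 - h x / c) \<le> c ^ k / h x ^ k"
      by (simp add: z_def power_divide)
  qed (use c_pos in \<open>auto intro!: continuous_intros\<close>)
  finally show ?thesis .
qed

end

text \<open>
  A bound for the mean square of \<open>1 - (c/h)\<^sup>k\<^sup>/\<^sup>2\<close>, that is, for the failure of \<open>h\<close> to be constant. The
  formula comes from the \<open>2k\<close> steps of the recursion for the moments, whose factors \<open>1 / (1 - j/c)\<close> are at
  most \<open>1 / (1 - 4k/d)\<close> for \<open>j \<le> 2k\<close> and \<open>c \<ge> d/2\<close>.
\<close>
definition defect :: "nat \<Rightarrow> nat \<Rightarrow> real" where
  "defect d k = 1 / (1 - 4 * real k / real d) ^ (2 * k) - 1"

context regularised_weight
begin

text \<open>
  With \<open>z = (c/h)\<^sup>k\<close>, the elementary bound \<open>(1 - \<surd>z)\<^sup>2 \<le> (1 - z)\<^sup>2\<close> reduces the claim to integer powers, and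
  \<open>E(1 - z)\<^sup>2 = 1 - 2 E z + E z\<^sup>2\<close> is estimated by \<open>E z \<ge> 1\<close> and the negative moment of order \<open>2k\<close>.
\<close>
lemma mean_defect_le:
  assumes k: "4 * real k < real d"
  shows "mean d (\<lambda>x. (1 - sqrt (c ^ k / h x ^ k))\<^sup>2) \<le> defect d k"
proof -
  define z where "z x = c ^ k / h x ^ k" for x
  have cz: "continuous_on (Rn d) z" unfolding z_def[abs_def] by (auto intro!: continuous_intros)
  have z0: "z x \<ge> 0" for x unfolding z_def using c_pos
    by (intro divide_nonneg_nonneg zero_le_power less_imp_le[OF h_pos] less_imp_le[OF c_pos])
  have iz: "integrable (tor {..<d}) z" "integrable (tor {..<d}) (\<lambda>x. (z x)\<^sup>2)"
     "integrable (tor {..<d}) (\<lambda>x. 1 :: real)"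
    by (intro continuous_Rn_integrable continuous_intros cz)+
  have "mean d (\<lambda>x. (1 - sqrt (z x))\<^sup>2) \<le> mean d (\<lambda>x. (1 - z x)\<^sup>2)"
  proof (rule mean_mono)
    fix x
    define r where "r = sqrt (z x)"
    have r: "r \<ge> 0" "z x = r\<^sup>2" using z0 by (auto simp: r_def)
    have "(1 - r)\<^sup>2 * 1 \<le> (1 - r)\<^sup>2 * (1 + r)\<^sup>2"
      using r by (intro mult_left_mono one_le_power) auto
    also have "\<dots> = (1 - r\<^sup>2)\<^sup>2" by (simp add: power2_eq_square algebra_simps)
    finally show "(1 - sqrt (z x))\<^sup>2 \<le> (1 - z x)\<^sup>2" by (simp add: r r_def[symmetric])
  qed (intro continuous_intros cz)+
  also have "\<dots> = mean d (\<lambda>x. 1 - 2 * z x + (z x)\<^sup>2)"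
    by (rule mean_cong) (simp add: power2_eq_square algebra_simps)
  also have "\<dots> = 1 - 2 * mean d z + mean d (\<lambda>x. (z x)\<^sup>2)"
    using iz by (simp add: mean_const)
  also have "\<dots> \<le> 1 - 2 * 1 + 1 / (1 - 4 * real k / real d) ^ (2 * k)"
  proof -
    have "mean d (\<lambda>x. (z x)\<^sup>2) = mean d (\<lambda>x. c ^ (2 * k) * (1 / h x ^ (2 * k)))"
      by (rule mean_cong) (simp add: z_def power_divide power_mult[symmetric] mult.commute)
    also have "\<dots> = c ^ (2 * k) * mean d (\<lambda>x. 1 / h x ^ (2 * k))"
      by (rule integral_mult_right_zero)
    also have "\<dots> \<le> 1 / (1 - 4 * real k / real d) ^ (2 * k)"
      using negative_moment_le[of "2 * k" "2 * k"] k by simp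
    finally show ?thesis using mean_inverse_power_ge[of k] unfolding z_def[abs_def] by linarith
  qed
  finally show ?thesis by (simp add: defect_def z_def)
qed

text \<open>
  Because \<open>f\<close> has mean zero, \<open>f h\<^sup>k\<^sup>/\<^sup>2\<close> has the same mean as
  \<open>f h\<^sup>k\<^sup>/\<^sup>2 (1 - (c/h)\<^sup>k\<^sup>/\<^sup>2)\<close>; the Cauchy-Schwarz inequality then applies.
\<close>
lemma mean_square_le:
  assumes cf: "continuous_on (Rn d) f" and m0: "mean d f = 0" and k: "4 * real k < real d"
  shows "(mean d (\<lambda>x. f x * sqrt (h x ^ k)))\<^sup>2 \<le> defect d k * mean d (\<lambda>x. (f x)\<^sup>2 * h x ^ k)"
proof -
  define g where "g x = f x * sqrt (h x ^ k)" for x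
  define r where "r x = sqrt (c ^ k / h x ^ k)" for x
  have cg: "continuous_on (Rn d) g" unfolding g_def[abs_def] by (intro continuous_intros cf)
  have cr: "continuous_on (Rn d) (\<lambda>x. 1 - r x)" unfolding r_def[abs_def] by (intro continuous_intros) auto
  have "mean d g = mean d (\<lambda>x. g x * (1 - r x) + sqrt (c ^ k) * f x)"
  proof (rule mean_cong)
    fix x
    have "g x * r x = f x * (sqrt (h x ^ k) * sqrt (c ^ k / h x ^ k))" by (simp add: g_def r_def)
    also have "sqrt (h x ^ k) * sqrt (c ^ k / h x ^ k) = sqrt (c ^ k)"
      by (subst real_sqrt_mult[symmetric]) simp
    finally show "g x = g x * (1 - r x) + sqrt (c ^ k) * f x" by (simp add: right_diff_distrib)
  qed
  also have "\<dots> = mean d (\<lambda>x. g x * (1 - r x)) + mean d (\<lambda>x. sqrt (c ^ k) * f x)"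
    by (rule mean_add) (intro continuous_intros cg cr cf)+
  also have "mean d (\<lambda>x. sqrt (c ^ k) * f x) = 0" using m0 by simp
  finally have "(mean d g)\<^sup>2 = (mean d (\<lambda>x. g x * (1 - r x)))\<^sup>2" by simp
  also have "\<dots> \<le> mean d (\<lambda>x. (g x)\<^sup>2) * mean d (\<lambda>x. (1 - r x)\<^sup>2)"
    by (rule mean_Cauchy_Schwarz[OF cg cr])
  also have "\<dots> \<le> mean d (\<lambda>x. (g x)\<^sup>2) * defect d k"
    using mean_defect_le[OF k] unfolding r_def by (intro mult_left_mono mean_nonneg) auto
  also have "mean d (\<lambda>x. (g x)\<^sup>2) = mean d (\<lambda>x. (f x)\<^sup>2 * h x ^ k)"
    by (rule mean_cong) (simp add: g_def power_mult_distrib less_imp_le)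
  finally show ?thesis unfolding g_def by (simp add: mult.commute)
qed

end

section \<open>Weighted inequalities with uniform constants\<close>

text \<open>
  The order of the integrals that contain \<open>\<nabla>h\<close>, relative to \<open>D + X\<close>.
\<close>
definition coupling :: "nat \<Rightarrow> nat \<Rightarrow> real" where
  "coupling d k = (real k + 2)\<^sup>2 / sqrt (real d)"

text \<open>
  The constants are those produced by \<open>absorb\<close>.
\<close>
definition loss :: "nat \<Rightarrow> nat \<Rightarrow> real" where
  "loss d k = 12 * coupling d k + 4 * defect d k"

text \<open>
  The dimensions in which the negative moments of order up to \<open>2k\<close> are under control, the hypotheses of
  \<open>absorb\<close> hold, and \<open>1 - 3 loss\<close> is nonnegative.
\<close>
definition high_dim :: "nat \<Rightarrow> nat \<Rightarrow> bool" where
  "high_dim d k \<longleftrightarrow> 4 * real k < real d \<and> coupling d k \<le> 1 / 4 \<and> defect d k \<le> 1 / 4 \<and> 3 * loss d k \<le> 1"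

lemma loss_tendsto: "(\<lambda>d. loss d k) \<longlonglongrightarrow> 0"
proof -
  have 1: "(\<lambda>d. coupling d k) \<longlonglongrightarrow> 0"
    unfolding coupling_def
    by (intro tendsto_divide_0[OF tendsto_const] filterlim_at_top_imp_at_infinity
        filterlim_compose[OF sqrt_at_top] filterlim_real_sequentially)
  have "(\<lambda>d. 4 * real k / real d) \<longlonglongrightarrow> 0"
    by (rule lim_const_over_n)
  then have 2: "(\<lambda>d. defect d k) \<longlonglongrightarrow> 0"
    unfolding defect_def by (auto intro!: tendsto_eq_intros)
  show ?thesis unfolding loss_def using 1 2 by (auto intro!: tendsto_eq_intros)
qed

lemma defect_nonneg:
  assumes "4 * real k < real d"
  shows "0 \<le> defect d k"
proof -
  have q: "0 < 1 - 4 * real k / real d" "1 - 4 * real k / real d \<le> 1" using assms by auto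
  then have "(1 - 4 * real k / real d) ^ (2 * k) \<le> 1" "0 < (1 - 4 * real k / real d) ^ (2 * k)"
    by (auto intro: power_le_one)
  then show ?thesis unfolding defect_def by simp
qed

lemma coupling_nonneg: "0 \<le> coupling d k" by (simp add: coupling_def)

lemma eventually_high_dim: "eventually (\<lambda>d. high_dim d k) sequentially"
proof -
  have l: "eventually (\<lambda>d. loss d k < 1 / 3) sequentially"
    using loss_tendsto by (rule order_tendstoD) simp
  have g: "eventually (\<lambda>d. d > 4 * k) sequentially" by (rule eventually_gt_at_top)
  show ?thesis
  proof (rule eventually_mono[OF eventually_conj[OF l g]])
    fix d assume a: "loss d k < 1 / 3 \<and> 4 * k < d"
    then have k: "4 * real k < real d" by linarith
    show "high_dim d k"
      unfolding high_dim_def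
    proof (intro conjI)
      have l: "12 * coupling d k + 4 * defect d k < 1 / 3" using a by (simp add: loss_def)
      show "coupling d k \<le> 1 / 4" using l defect_nonneg[OF k] by simp
      show "defect d k \<le> 1 / 4" using l coupling_nonneg[of d k] by simp
      show "3 * loss d k \<le> 1" using a by simp
    qed (rule k)
  qed
qed

text \<open>
  The error terms may contain \<open>X\<close> and \<open>N\<close> themselves. A first pass with the crude values
  \<open>\<tau>, \<kappa> \<le> 1/4\<close> gives \<open>X \<le> 5 D\<close> and \<open>N \<le> 4 D\<close>; inserting this, all errors become small multiples of \<open>D\<close>.
\<close>
lemma absorb:
  fixes D N X \<tau> \<kappa> :: real
  assumes "0 \<le> D" "0 \<le> N" "0 \<le> X" "0 \<le> \<tau>" "\<tau> \<le> 1 / 4" "0 \<le> \<kappa>" "\<kappa> \<le> 1 / 4"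
    and 1: "(1 - \<kappa>) * N \<le> D + \<tau> * (D + X)" and 2: "\<bar>X - N\<bar> \<le> \<tau> * (D + X)"
  shows "N \<le> (1 + (12 * \<tau> + 4 * \<kappa>)) * D" "X \<le> (1 + (12 * \<tau> + 4 * \<kappa>)) * D"
    "\<tau> * (D + X) \<le> (12 * \<tau> + 4 * \<kappa>) * D"
proof -
  have a: "\<tau> * (D + X) \<le> 1 / 4 * (D + X)" using assms by (intro mult_right_mono) auto
  have b: "\<kappa> * N \<le> 1 / 4 * N" using assms by (intro mult_right_mono) auto
  have N: "N - \<kappa> * N \<le> D + \<tau> * (D + X)" using 1 by (simp add: left_diff_distrib)
  have "X \<le> N + \<tau> * (D + X)" using 2 by linarith
  then have X5: "X \<le> 5 * D" using a b N assms(1-3) by argo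
  have N4: "N \<le> 4 * D" using X5 a b N assms(1-3) by argo
  have c: "\<tau> * (D + X) \<le> \<tau> * (6 * D)" using X5 assms by (intro mult_left_mono) auto
  have e: "\<kappa> * N \<le> \<kappa> * (4 * D)" using N4 assms by (intro mult_left_mono) auto
  have n: "0 \<le> \<tau> * D" "0 \<le> \<kappa> * D" using assms by auto
  have x: "(1 + (12 * \<tau> + 4 * \<kappa>)) * D = D + 12 * (\<tau> * D) + 4 * (\<kappa> * D)"
    "(12 * \<tau> + 4 * \<kappa>) * D = 12 * (\<tau> * D) + 4 * (\<kappa> * D)" by (simp_all add: algebra_simps)
  show "N \<le> (1 + (12 * \<tau> + 4 * \<kappa>)) * D" unfolding x using c e n N by simp
  show "X \<le> (1 + (12 * \<tau> + 4 * \<kappa>)) * D" unfolding x using c e n N 2 by simp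
  show "\<tau> * (D + X) \<le> (12 * \<tau> + 4 * \<kappa>) * D" unfolding x using c n by simp
qed

text \<open>
  A test function with gradient \<open>p\<close>. Below \<open>S = |\<nabla>\<phi>|\<^sup>2\<close> and \<open>Q = \<nabla>\<phi> \<cdot> \<nabla>h\<close>, and the letters \<open>D\<close>, \<open>N\<close>, \<open>X\<close>, \<open>J\<close>
  stand for the means of the introduction with \<open>h\<close> in place of \<open>\<omega>\<close> and \<open>c\<close> in place of \<open>d/2\<close>. The powers are written \<open>h\<^sup>k / h\<close> and
  \<open>h\<^sup>k / h\<^sup>2\<close> so that \<open>k = 0\<close> yields the negative powers that are meant.
\<close>
locale regularised_test = regularised_weight +
  fixes \<phi> :: "(nat \<Rightarrow> real) \<Rightarrow> real" and p :: "nat \<Rightarrow> (nat \<Rightarrow> real) \<Rightarrow> real" and k :: nat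
  assumes p: "\<And>j. j < d \<Longrightarrow> periodic_partial d j \<phi> (p j)"
begin

definition S where "S x = (\<Sum>j<d. (p j x)\<^sup>2)"
definition Q where "Q x = (\<Sum>j<d. p j x * w j x)"
definition D where "D = mean d (\<lambda>x. S x * h x ^ k)"
definition N where "N = mean d (\<lambda>x. (\<phi> x)\<^sup>2 * h x ^ k)"
definition X where "X = c * mean d (\<lambda>x. (\<phi> x)\<^sup>2 * (h x ^ k / h x))"
definition J where "J = mean d (\<lambda>x. \<phi> x * Q x * (h x ^ k / h x))"
definition W where "W = mean d (\<lambda>x. (\<phi> x)\<^sup>2 * R x * (h x ^ k / (h x)\<^sup>2))"

lemma continuous_\<phi>: "continuous_on (Rn d) \<phi>"
  using p[of 0] d1 by (simp add: periodic_partial_def)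

lemma continuous_p: "j < d \<Longrightarrow> continuous_on (Rn d) (p j)"
  using p by (simp add: periodic_partial_def)

lemma continuous_S: "continuous_on (Rn d) S"
  unfolding S_def[abs_def] by (intro continuous_intros continuous_p) auto

lemma continuous_Q: "continuous_on (Rn d) Q"
  unfolding Q_def[abs_def] by (intro continuous_intros continuous_p) auto

lemma continuous_hq: "continuous_on A (\<lambda>x. h x ^ k / h x)" "continuous_on A (\<lambda>x. h x ^ k / (h x)\<^sup>2)"
  "continuous_on A (\<lambda>x. h x ^ k)"
  by (auto intro!: continuous_intros)

lemmas cont = continuous_\<phi> continuous_S continuous_Q continuous_hq continuous_R

lemma hq_pos: "0 < h x ^ k / h x" "0 < h x ^ k / (h x)\<^sup>2" "0 < h x ^ k"
  using h_pos[of x] by simp_all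

lemma S_nonneg: "0 \<le> S x" unfolding S_def by (intro sum_nonneg) auto

lemma D_nonneg: "0 \<le> D"
  unfolding D_def using S_nonneg hq_pos by (intro mean_nonneg mult_nonneg_nonneg) (auto intro: less_imp_le)

lemma N_nonneg: "0 \<le> N"
  unfolding N_def using hq_pos by (intro mean_nonneg mult_nonneg_nonneg) (auto intro: less_imp_le)

lemma X_nonneg: "0 \<le> X"
  unfolding X_def using hq_pos c_pos by (intro mult_nonneg_nonneg mean_nonneg) (auto intro: less_imp_le)

lemma W_bounds: "0 \<le> W" "W \<le> 2 / real d * X"
proof -
  show "0 \<le> W"
    unfolding W_def using hq_pos R_nonneg by (intro mean_nonneg mult_nonneg_nonneg) (auto intro: less_imp_le)
  have "W \<le> mean d (\<lambda>x. (\<phi> x)\<^sup>2 * (h x ^ k / h x))"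
    unfolding W_def
  proof (rule mean_mono)
    fix x
    have "R x * (h x ^ k / (h x)\<^sup>2) \<le> h x * (h x ^ k / (h x)\<^sup>2)"
      using R_le hq_pos by (intro mult_right_mono) (auto intro: less_imp_le)
    also have "\<dots> = h x ^ k / h x" by (simp add: power2_eq_square)
    finally show "(\<phi> x)\<^sup>2 * R x * (h x ^ k / (h x)\<^sup>2) \<le> (\<phi> x)\<^sup>2 * (h x ^ k / h x)"
      unfolding mult.assoc by (intro mult_left_mono) auto
  qed (intro continuous_on_mult continuous_on_power cont)+
  also have "\<dots> = X / c" using c_pos by (simp add: X_def)
  also have "\<dots> \<le> X / (real d / 2)" using c_ge d1 X_nonneg by (intro divide_left_mono mult_pos_pos) (auto simp: c_pos)
  finally show "W \<le> 2 / real d * X" by (simp add: mult.commute)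
qed

lemma Q_square_le: "(Q x)\<^sup>2 \<le> S x * h x"
proof -
  have "(Q x)\<^sup>2 \<le> S x * R x" unfolding Q_def S_def R_def by (rule Cauchy_Schwarz_ineq_sum)
  also have "\<dots> \<le> S x * h x" using R_le S_nonneg by (intro mult_left_mono) auto
  finally show ?thesis .
qed

text \<open>
  Pointwise \<open>|Q|\<^sup>2 \<le> S h\<close>, so \<open>2 |\<phi> Q| \<le> s S h + \<phi>\<^sup>2 / s\<close> for each \<open>s > 0\<close>. The choice \<open>s = d\<^sup>-\<^sup>1\<^sup>/\<^sup>2\<close> balances the
  two terms, since \<open>X\<close> carries the factor \<open>c \<ge> d/2\<close>.
\<close>
lemma J_bound: "\<bar>J\<bar> \<le> (D + 2 * X) / (2 * sqrt (real d))"
proof -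
  define s where "s = 1 / sqrt (real d)"
  have s: "s > 0" "1 / s = s * real d" using d1 by (auto simp: s_def real_div_sqrt)
  define Y where "Y = mean d (\<lambda>x. (\<phi> x)\<^sup>2 * (h x ^ k / h x))"
  have Y0: "Y \<ge> 0" using X_nonneg c_pos by (simp add: X_def Y_def zero_le_mult_iff)
  have pw: "\<bar>\<phi> x * Q x * (h x ^ k / h x)\<bar> \<le> s / 2 * (S x * h x ^ k) + 1 / s / 2 * ((\<phi> x)\<^sup>2 * (h x ^ k / h x))" for x
  proof -
    have "0 \<le> (s * \<bar>Q x\<bar> - \<bar>\<phi> x\<bar>)\<^sup>2 / (2 * s)" using s by simp
    also have "\<dots> = s / 2 * (Q x)\<^sup>2 + 1 / s / 2 * (\<phi> x)\<^sup>2 - \<bar>\<phi> x * Q x\<bar>"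
    proof -
      have "(s * \<bar>Q x\<bar> - \<bar>\<phi> x\<bar>)\<^sup>2 = s * s * (Q x)\<^sup>2 + (\<phi> x)\<^sup>2 - 2 * s * \<bar>\<phi> x * Q x\<bar>"
        by (simp add: power2_diff power_mult_distrib abs_mult power2_eq_square[of s])
      then show ?thesis using s(1) by (simp only:) (simp add: field_simps)
    qed
    finally have "\<bar>\<phi> x * Q x\<bar> \<le> s / 2 * (Q x)\<^sup>2 + 1 / s / 2 * (\<phi> x)\<^sup>2" by simp
    also have "\<dots> \<le> s / 2 * (S x * h x) + 1 / s / 2 * (\<phi> x)\<^sup>2"
      using Q_square_le[of x] s by (intro add_right_mono mult_left_mono) auto
    finally have "\<bar>\<phi> x * Q x\<bar> * (h x ^ k / h x) \<le> (s / 2 * (S x * h x) + 1 / s / 2 * (\<phi> x)\<^sup>2) * (h x ^ k / h x)"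
      using hq_pos by (intro mult_right_mono) (auto intro: less_imp_le)
    also have "\<dots> = s / 2 * (S x * (h x * (h x ^ k / h x))) + 1 / s / 2 * ((\<phi> x)\<^sup>2 * (h x ^ k / h x))"
      by (simp only: distrib_right mult.assoc)
    also have "h x * (h x ^ k / h x) = h x ^ k" by simp
    finally show ?thesis using hq_pos(1)[of x] by (simp only: abs_mult abs_of_pos)
  qed
  have "\<bar>J\<bar> \<le> mean d (\<lambda>x. \<bar>\<phi> x * Q x * (h x ^ k / h x)\<bar>)" unfolding J_def by (rule integral_abs_bound)
  also have "\<dots> \<le> mean d (\<lambda>x. s / 2 * (S x * h x ^ k) + 1 / s / 2 * ((\<phi> x)\<^sup>2 * (h x ^ k / h x)))"
    by (rule mean_mono[OF _ _ pw]) (intro continuous_intros cont)+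
  also have "\<dots> = s / 2 * D + 1 / s / 2 * Y"
    unfolding D_def Y_def by (rule mean_linear) (intro continuous_on_mult continuous_on_power cont)+
  also have "1 / s / 2 * Y \<le> s * X"
  proof -
    have "real d / 2 * Y \<le> X" using c_ge Y0 unfolding X_def Y_def by (intro mult_right_mono) auto
    then have "s * (real d / 2 * Y) \<le> s * X" using s by (intro mult_left_mono) auto
    then show ?thesis using s by simp
  qed
  finally show ?thesis unfolding s_def by (simp add: add_divide_distrib mult.commute)
qed

text \<open>
  Green's identity with \<open>F = \<phi>\<^sup>2 h\<^sup>k\<^sup>-\<^sup>1\<close>.
\<close>
lemma X_identity: "X = N - 2 * J - (real k - 1) * W"
proof -
  have der: "((\<lambda>y. y ^ k / y) has_real_derivative (real k - 1) * (y ^ k / y\<^sup>2)) (at y)" if "y > 0" for y :: real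
  proof -
    have "((\<lambda>y. y ^ k) has_real_derivative real k * (y ^ k / y)) (at y)"
      using DERIV_pow[of k y] that by (cases k) auto
    from DERIV_divide[OF this DERIV_ident] that
    have "((\<lambda>y. y ^ k / y) has_real_derivative (real k * (y ^ k / y) * y - y ^ k * 1) / (y * y)) (at y)" by simp
    moreover have "(real k * (y ^ k / y) * y - y ^ k * 1) / (y * y) = (real k - 1) * (y ^ k / y\<^sup>2)"
      using that by (simp add: power2_eq_square left_diff_distrib diff_divide_distrib)
    ultimately show ?thesis by simp
  qed
  have cder: "continuous_on {0<..} (\<lambda>y::real. (real k - 1) * (y ^ k / y\<^sup>2))"
    by (auto intro!: continuous_intros)
  have "periodic_partial d j (\<lambda>x. \<phi> x * \<phi> x * (h x ^ k / h x))
    (\<lambda>x. (p j x * \<phi> x + \<phi> x * p j x) * (h x ^ k / h x) + \<phi> x * \<phi> x * ((real k - 1) * (h x ^ k / (h x)\<^sup>2) * w j x))"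
    if j: "j < d" for j
    by (rule periodic_partial_mult[OF periodic_partial_mult[OF p p] partial_compose_h[OF der cder]]) (use j in auto)
  from green[OF this]
  have "c * mean d (\<lambda>x. \<phi> x * \<phi> x * (h x ^ k / h x)) = mean d (\<lambda>x. \<phi> x * \<phi> x * (h x ^ k / h x) * h x)
    - mean d (\<lambda>x. \<Sum>j<d. ((p j x * \<phi> x + \<phi> x * p j x) * (h x ^ k / h x) + \<phi> x * \<phi> x * ((real k - 1) * (h x ^ k / (h x)\<^sup>2) * w j x)) * w j x)" .
  moreover have "c * mean d (\<lambda>x. \<phi> x * \<phi> x * (h x ^ k / h x)) = X" by (simp add: X_def power2_eq_square)
  moreover have "mean d (\<lambda>x. \<phi> x * \<phi> x * (h x ^ k / h x) * h x) = N"
    unfolding N_def by (rule mean_cong) (simp add: power2_eq_square)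
  moreover have "mean d (\<lambda>x. \<Sum>j<d. ((p j x * \<phi> x + \<phi> x * p j x) * (h x ^ k / h x) + \<phi> x * \<phi> x * ((real k - 1) * (h x ^ k / (h x)\<^sup>2) * w j x)) * w j x)
     = mean d (\<lambda>x. 2 * (\<phi> x * Q x * (h x ^ k / h x)) + (real k - 1) * ((\<phi> x)\<^sup>2 * R x * (h x ^ k / (h x)\<^sup>2)))"
  proof (rule mean_cong)
    fix x
    define A where "A = h x ^ k / h x"
    define B where "B = (real k - 1) * (h x ^ k / (h x)\<^sup>2)"
    have "(\<Sum>j<d. ((p j x * \<phi> x + \<phi> x * p j x) * A + \<phi> x * \<phi> x * (B * w j x)) * w j x)
      = (\<Sum>j<d. 2 * \<phi> x * A * (p j x * w j x) + (\<phi> x)\<^sup>2 * B * (w j x)\<^sup>2)"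
      by (intro sum.cong refl) (simp add: power2_eq_square algebra_simps)
    also have "\<dots> = 2 * \<phi> x * A * Q x + (\<phi> x)\<^sup>2 * B * R x"
      by (simp add: sum.distrib Q_def R_def sum_distrib_left)
    finally show "(\<Sum>j<d. ((p j x * \<phi> x + \<phi> x * p j x) * (h x ^ k / h x) + \<phi> x * \<phi> x * ((real k - 1) * (h x ^ k / (h x)\<^sup>2) * w j x)) * w j x)
      = 2 * (\<phi> x * Q x * (h x ^ k / h x)) + (real k - 1) * ((\<phi> x)\<^sup>2 * R x * (h x ^ k / (h x)\<^sup>2))"
      unfolding A_def[symmetric] B_def[symmetric] by (simp add: B_def mult_ac)
  qed
  moreover have "\<dots> = 2 * J + (real k - 1) * W"
    unfolding J_def W_def by (rule mean_linear) (intro continuous_on_mult continuous_on_power cont)+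
  ultimately show ?thesis by simp
qed

text \<open>
  The Poincare inequality for \<open>\<phi> h\<^sup>k\<^sup>/\<^sup>2\<close>, with the square of its gradient expanded.
\<close>
lemma N_le:
  assumes m0: "mean d \<phi> = 0" and k: "4 * real k < real d"
  shows "(1 - defect d k) * N \<le> D + real k * J + (real k)\<^sup>2 / 4 * W"
proof -
  define v where "v y = sqrt (y ^ k)" for y :: real
  define v' where "v' y = real k * (y ^ k / y) / (2 * sqrt (y ^ k))" for y :: real
  have der: "(v has_real_derivative v' y) (at y)" if "y > 0" for y
  proof -
    have d: "((\<lambda>y. y ^ k) has_real_derivative real k * (y ^ k / y)) (at y)"
      using DERIV_pow[of k y] that by (cases k) auto
    have "0 < y ^ k" using that by simp
    from DERIV_chain2[where g = "\<lambda>y. y ^ k" and f = sqrt and x = y, OF DERIV_real_sqrt[OF this] d] have "((\<lambda>y. sqrt (y ^ k)) has_real_derivative inverse (sqrt (y ^ k)) / 2 * (real k * (y ^ k / y))) (at y)" .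
    moreover have "inverse (sqrt (y ^ k)) / 2 * (real k * (y ^ k / y)) = v' y"
    proof -
      have "inverse a / 2 * b = b / (2 * a)" for a b :: real
        by (cases "a = 0") (simp_all add: field_simps)
      then show ?thesis by (simp only: v'_def)
    qed
    ultimately show ?thesis unfolding v_def[abs_def] by simp
  qed
  have cder: "continuous_on {0<..} v'"
    unfolding v'_def[abs_def] by (auto intro!: continuous_intros)
  have v2: "(v (h x))\<^sup>2 = h x ^ k" for x unfolding v_def by (simp add: less_imp_le)
  have vv': "v (h x) * v' (h x) = real k / 2 * (h x ^ k / h x)" for x
    unfolding v_def v'_def using h_pos[of x] by simp
  have v'2: "(v' (h x))\<^sup>2 = (real k)\<^sup>2 / 4 * (h x ^ k / (h x)\<^sup>2)" for x
    unfolding v'_def power_divide power_mult_distrib real_sqrt_pow2[OF less_imp_le[OF hq_pos(3)]]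
    by (simp add: power2_eq_square)
  have pp: "periodic_partial d j (\<lambda>x. \<phi> x * v (h x)) (\<lambda>x. p j x * v (h x) + \<phi> x * (v' (h x) * w j x))" if "j < d" for j
    by (rule periodic_partial_mult[OF p[OF that] partial_compose_h[OF der cder that]])
  have cpsi: "continuous_on (Rn d) (\<lambda>x. \<phi> x * v (h x))"
    unfolding v_def by (intro continuous_intros cont)
  have "mean d (\<lambda>x. (\<phi> x * v (h x))\<^sup>2) - (mean d (\<lambda>x. \<phi> x * v (h x)))\<^sup>2
    \<le> mean d (\<lambda>x. \<Sum>j<d. (p j x * v (h x) + \<phi> x * (v' (h x) * w j x))\<^sup>2)"
    by (rule torus_poincare[OF pp cpsi])
  moreover have "mean d (\<lambda>x. (\<phi> x * v (h x))\<^sup>2) = N"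
    unfolding N_def by (simp add: power_mult_distrib v2)
  moreover have "(mean d (\<lambda>x. \<phi> x * v (h x)))\<^sup>2 \<le> defect d k * N"
    unfolding v_def N_def by (rule mean_square_le[OF continuous_\<phi> m0 k])
  moreover have "mean d (\<lambda>x. \<Sum>j<d. (p j x * v (h x) + \<phi> x * (v' (h x) * w j x))\<^sup>2)
    = mean d (\<lambda>x. S x * h x ^ k + real k * (\<phi> x * Q x * (h x ^ k / h x)) + (real k)\<^sup>2 / 4 * ((\<phi> x)\<^sup>2 * R x * (h x ^ k / (h x)\<^sup>2)))"
  proof (rule mean_cong)
    fix x
    have "(\<Sum>j<d. (p j x * v (h x) + \<phi> x * (v' (h x) * w j x))\<^sup>2)
      = (\<Sum>j<d. (p j x)\<^sup>2 * (v (h x))\<^sup>2 + 2 * \<phi> x * (v (h x) * v' (h x)) * (p j x * w j x) + (\<phi> x)\<^sup>2 * (v' (h x))\<^sup>2 * (w j x)\<^sup>2)"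
      by (intro sum.cong refl) (simp add: power2_eq_square algebra_simps)
    also have "\<dots> = S x * (v (h x))\<^sup>2 + 2 * \<phi> x * (v (h x) * v' (h x)) * Q x + (\<phi> x)\<^sup>2 * (v' (h x))\<^sup>2 * R x"
      by (simp add: sum.distrib Q_def R_def S_def sum_distrib_left sum_distrib_right)
    also have "\<dots> = S x * h x ^ k + real k * (\<phi> x * Q x * (h x ^ k / h x)) + (real k)\<^sup>2 / 4 * ((\<phi> x)\<^sup>2 * R x * (h x ^ k / (h x)\<^sup>2))"
      unfolding v2 vv' v'2 by (simp add: mult_ac)
    finally show "(\<Sum>j<d. (p j x * v (h x) + \<phi> x * (v' (h x) * w j x))\<^sup>2)
      = S x * h x ^ k + real k * (\<phi> x * Q x * (h x ^ k / h x)) + (real k)\<^sup>2 / 4 * ((\<phi> x)\<^sup>2 * R x * (h x ^ k / (h x)\<^sup>2))" .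
  qed
  moreover have "\<dots> = D + real k * J + (real k)\<^sup>2 / 4 * W"
  proof -
    have "mean d (\<lambda>x. S x * h x ^ k + real k * (\<phi> x * Q x * (h x ^ k / h x)) + (real k)\<^sup>2 / 4 * ((\<phi> x)\<^sup>2 * R x * (h x ^ k / (h x)\<^sup>2)))
      = mean d (\<lambda>x. 1 * (S x * h x ^ k) + real k * (\<phi> x * Q x * (h x ^ k / h x))) + mean d (\<lambda>x. (real k)\<^sup>2 / 4 * ((\<phi> x)\<^sup>2 * R x * (h x ^ k / (h x)\<^sup>2)))"
      unfolding mult_1 by (rule mean_add) (intro continuous_on_add continuous_on_mult continuous_on_power continuous_on_const cont)+
    also have "mean d (\<lambda>x. 1 * (S x * h x ^ k) + real k * (\<phi> x * Q x * (h x ^ k / h x))) = 1 * D + real k * J"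
      unfolding D_def J_def by (rule mean_linear) (intro continuous_on_mult continuous_on_power cont)+
    finally show ?thesis unfolding W_def by (simp only: integral_mult_right_zero mult_1)
  qed
  ultimately show ?thesis by (simp add: left_diff_distrib)
qed

text \<open>
  With \<open>Y = d\<^sup>-\<^sup>1\<^sup>/\<^sup>2 (D + X)\<close> one has \<open>|J| \<le> Y\<close> and \<open>0 \<le> W \<le> 2 Y\<close>; the factor \<open>(k + 2)\<^sup>2\<close> dominates all
  coefficients that occur.
\<close>
lemma coupling_bounds:
  shows "\<bar>X - N\<bar> \<le> coupling d k * (D + X)" "\<bar>real k * J\<bar> \<le> coupling d k * (D + X)"
    "real k * J + (real k)\<^sup>2 / 4 * W \<le> coupling d k * (D + X)"
proof -
  define s where "s = 1 / sqrt (real d)"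
  define Y where "Y = s * (D + X)"
  have s: "0 < s" "s \<le> 1" using d1 by (auto simp: s_def)
  have Y0: "0 \<le> Y" using s D_nonneg X_nonneg by (simp add: Y_def)
  have sX: "0 \<le> s * X" "0 \<le> s * D" using s D_nonneg X_nonneg by auto
  have J: "\<bar>J\<bar> \<le> Y"
  proof -
    have "(D + 2 * X) / (2 * sqrt (real d)) = s * D / 2 + s * X" by (simp add: s_def add_divide_distrib)
    then show ?thesis using J_bound sX by (simp add: Y_def distrib_left)
  qed
  have W: "0 \<le> W" "W \<le> 2 * Y"
  proof -
    have "2 / real d = 2 * (s * s)" using d1 by (simp add: s_def)
    then have "W \<le> 2 * (s * (s * X))" using W_bounds by (simp add: mult.assoc)
    also have "\<dots> \<le> 2 * (1 * (s * X))" using s sX by (intro mult_left_mono mult_right_mono) auto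
    finally show "W \<le> 2 * Y" using sX by (simp add: Y_def distrib_left)
  qed (rule W_bounds)
  have cY: "coupling d k * (D + X) = (real k + 2)\<^sup>2 * Y" by (simp add: coupling_def Y_def s_def)
  have kY: "0 \<le> real k * Y" "0 \<le> (real k)\<^sup>2 * Y" using Y0 by auto
  have exp: "(real k + 2)\<^sup>2 * Y = (real k)\<^sup>2 * Y + 4 * (real k * Y) + 4 * Y"
    by (simp add: power2_eq_square algebra_simps)
  have kJ: "\<bar>real k * J\<bar> \<le> real k * Y" unfolding abs_mult using J by (simp add: mult_left_mono)
  have kE: "real k * W \<le> real k * (2 * Y)" "0 \<le> real k * W"
    using W by (auto intro: mult_left_mono)
  have kE2: "(real k)\<^sup>2 * W \<le> (real k)\<^sup>2 * (2 * Y)" using W by (intro mult_left_mono) auto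
  have "X - N = - 2 * J - (real k * W - W)" using X_identity by (simp add: left_diff_distrib)
  then have "\<bar>X - N\<bar> \<le> 2 * Y + real k * (2 * Y) + 2 * Y" using J W kE by linarith
  then show "\<bar>X - N\<bar> \<le> coupling d k * (D + X)" unfolding cY exp using kY by simp
  show "\<bar>real k * J\<bar> \<le> coupling d k * (D + X)" unfolding cY exp using kJ kY Y0 by linarith
  have "real k * J + (real k)\<^sup>2 / 4 * W \<le> real k * Y + (real k)\<^sup>2 * Y / 2"
    using kJ kE2 by simp
  then show "real k * J + (real k)\<^sup>2 / 4 * W \<le> coupling d k * (D + X)"
    unfolding cY exp using kY Y0 by linarith
qed

lemma first_order_estimates:
  assumes hd: "high_dim d k" and m0: "mean d \<phi> = 0"
  shows "N \<le> (1 + loss d k) * D" "X \<le> (1 + loss d k) * D" "\<bar>real k * J\<bar> \<le> loss d k * D"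
proof -
  have k: "4 * real k < real d" using hd by (simp add: high_dim_def)
  have "(1 - defect d k) * N \<le> D + coupling d k * (D + X)"
    using N_le[OF m0 k] coupling_bounds(3) by linarith
  note absorb[OF D_nonneg N_nonneg X_nonneg coupling_nonneg _ defect_nonneg[OF k] _ this coupling_bounds(1)]
  then show "N \<le> (1 + loss d k) * D" "X \<le> (1 + loss d k) * D" "\<bar>real k * J\<bar> \<le> loss d k * D"
    using hd coupling_bounds(2) unfolding high_dim_def loss_def by auto
qed

definition L where "L r x = (\<Sum>j<d. r j x)"

context
  fixes r :: "nat \<Rightarrow> (nat \<Rightarrow> real) \<Rightarrow> real"
  assumes r: "\<And>j. j < d \<Longrightarrow> periodic_partial d j (p j) (r j)"
begin

lemma continuous_L: "continuous_on (Rn d) (L r)"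
  unfolding L_def[abs_def] using r by (intro continuous_intros) (simp add: periodic_partial_def)

text \<open>
  The total derivative of \<open>\<phi> \<nabla>\<phi> h\<^sup>k\<close> has mean zero.
\<close>
lemma energy_identity: "D = - mean d (\<lambda>x. \<phi> x * L r x * h x ^ k) - real k * J"
proof -
  have der: "((\<lambda>y. y ^ k) has_real_derivative real k * (y ^ k / y)) (at y)" if "y > 0" for y :: real
    using DERIV_pow[of k y] that by (cases k) auto
  have cder: "continuous_on {0<..} (\<lambda>y::real. real k * (y ^ k / y))"
    by (auto intro!: continuous_intros)
  have pp: "periodic_partial d j (\<lambda>x. \<phi> x * p j x * h x ^ k)
    (\<lambda>x. (p j x * p j x + \<phi> x * r j x) * h x ^ k + \<phi> x * p j x * (real k * (h x ^ k / h x) * w j x))"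
    if j: "j < d" for j
    by (rule periodic_partial_mult[OF periodic_partial_mult[OF p[OF j] r[OF j]] partial_compose_h[OF der cder j]])
  have "0 = (\<Sum>j<d. mean d (\<lambda>x. (p j x * p j x + \<phi> x * r j x) * h x ^ k + \<phi> x * p j x * (real k * (h x ^ k / h x) * w j x)))"
    using mean_partial_eq_0[OF pp] by simp
  also have "\<dots> = mean d (\<lambda>x. \<Sum>j<d. (p j x * p j x + \<phi> x * r j x) * h x ^ k + \<phi> x * p j x * (real k * (h x ^ k / h x) * w j x))"
  proof (rule Bochner_Integration.integral_sum[symmetric], rule continuous_Rn_integrable)
    fix j assume "j \<in> {..<d}"
    then show "continuous_on (Rn d) (\<lambda>x. (p j x * p j x + \<phi> x * r j x) * h x ^ k + \<phi> x * p j x * (real k * (h x ^ k / h x) * w j x))"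
      using pp[of j] by (simp add: periodic_partial_def)
  qed
  also have "\<dots> = mean d (\<lambda>x. S x * h x ^ k + (\<phi> x * L r x * h x ^ k + real k * (\<phi> x * Q x * (h x ^ k / h x))))"
  proof (rule mean_cong)
    fix x
    have "(\<Sum>j<d. (p j x * p j x + \<phi> x * r j x) * a + \<phi> x * p j x * (b * w j x))
      = S x * a + (\<phi> x * L r x * a + b * \<phi> x * Q x)" for a b
      by (simp add: S_def L_def Q_def sum.distrib sum_distrib_left sum_distrib_right power2_eq_square algebra_simps)
    from this[of "h x ^ k" "real k * (h x ^ k / h x)"]
    show "(\<Sum>j<d. (p j x * p j x + \<phi> x * r j x) * h x ^ k + \<phi> x * p j x * (real k * (h x ^ k / h x) * w j x))
      = S x * h x ^ k + (\<phi> x * L r x * h x ^ k + real k * (\<phi> x * Q x * (h x ^ k / h x)))"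
      by (simp add: mult_ac)
  qed
  also have "\<dots> = D + mean d (\<lambda>x. 1 * (\<phi> x * L r x * h x ^ k) + real k * (\<phi> x * Q x * (h x ^ k / h x)))"
    unfolding D_def mult_1
    by (rule mean_add) (intro continuous_on_add continuous_on_mult continuous_on_const cont continuous_L)+
  also have "mean d (\<lambda>x. 1 * (\<phi> x * L r x * h x ^ k) + real k * (\<phi> x * Q x * (h x ^ k / h x)))
    = 1 * mean d (\<lambda>x. \<phi> x * L r x * h x ^ k) + real k * J"
    unfolding J_def by (rule mean_linear) (intro continuous_on_mult cont continuous_L)+
  finally show ?thesis by simp
qed

text \<open>
  Both parts bound \<open>- 2 \<phi> \<Delta>\<phi>\<close> by \<open>a |\<Delta>\<phi>|\<^sup>2 + \<phi>\<^sup>2 / a\<close> in the energy identity: the first with \<open>a = 1\<close>, the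
  second with \<open>a = h / c\<close>. One copy of \<open>D\<close> and the small terms are then absorbed.
\<close>
lemma second_order_estimates:
  assumes hd: "high_dim d k" and m0: "mean d \<phi> = 0"
  shows "(1 - 3 * loss d k) * D \<le> mean d (\<lambda>x. (L r x)\<^sup>2 * h x ^ k)"
    and "c * (1 - 3 * loss d k) * D \<le> mean d (\<lambda>x. (L r x)\<^sup>2 * h x ^ Suc k)"
proof -
  note fo = first_order_estimates[OF hd m0]
  have cL: "continuous_on (Rn d) (\<lambda>x. \<phi> x * L r x * h x ^ k)" "continuous_on (Rn d) (\<lambda>x. (L r x)\<^sup>2 * h x ^ k)"
    "continuous_on (Rn d) (\<lambda>x. (L r x)\<^sup>2 * h x ^ Suc k)" "continuous_on (Rn d) (\<lambda>x. (\<phi> x)\<^sup>2 * h x ^ k)"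
    "continuous_on (Rn d) (\<lambda>x. (\<phi> x)\<^sup>2 * (h x ^ k / h x))"
    by (intro continuous_on_mult continuous_on_power cont continuous_L continuous_h)+
  have D: "2 * D = mean d (\<lambda>x. (- 2) * (\<phi> x * L r x * h x ^ k)) - 2 * (real k * J)"
    using energy_identity by simp
  have le: "- 2 * (\<phi> x * L r x) \<le> a * (L r x)\<^sup>2 + 1 / a * (\<phi> x)\<^sup>2" if "a > 0" for a x
  proof -
    have "0 \<le> (a * L r x + \<phi> x)\<^sup>2 / a" using that by simp
    also have "\<dots> = a * (L r x)\<^sup>2 + 1 / a * (\<phi> x)\<^sup>2 + 2 * (\<phi> x * L r x)"
      using that by (simp add: power2_eq_square field_simps)
    finally show ?thesis by simp
  qed
  have "mean d (\<lambda>x. (- 2) * (\<phi> x * L r x * h x ^ k)) \<le> mean d (\<lambda>x. 1 * ((L r x)\<^sup>2 * h x ^ k) + 1 * ((\<phi> x)\<^sup>2 * h x ^ k))"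
  proof (rule mean_mono)
    fix x
    have "- 2 * (\<phi> x * L r x) * h x ^ k \<le> ((L r x)\<^sup>2 + (\<phi> x)\<^sup>2) * h x ^ k"
      using le[of 1 x] less_imp_le[OF hq_pos(3)[of x]] by (intro mult_right_mono) auto
    then show "(- 2) * (\<phi> x * L r x * h x ^ k) \<le> 1 * ((L r x)\<^sup>2 * h x ^ k) + 1 * ((\<phi> x)\<^sup>2 * h x ^ k)"
      by (simp add: algebra_simps)
  qed (intro continuous_on_add continuous_on_mult[OF continuous_on_const] cL)+
  also have "\<dots> = mean d (\<lambda>x. (L r x)\<^sup>2 * h x ^ k) + N"
    unfolding N_def by (subst mean_linear[OF cL(2,4)]) simp
  finally have "2 * D \<le> mean d (\<lambda>x. (L r x)\<^sup>2 * h x ^ k) + (1 + loss d k) * D + 2 * (loss d k * D)"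
    using D fo by linarith
  then show "(1 - 3 * loss d k) * D \<le> mean d (\<lambda>x. (L r x)\<^sup>2 * h x ^ k)"
    by (simp add: algebra_simps)
  have "mean d (\<lambda>x. (- 2) * (\<phi> x * L r x * h x ^ k))
    \<le> mean d (\<lambda>x. 1 / c * ((L r x)\<^sup>2 * h x ^ Suc k) + c * ((\<phi> x)\<^sup>2 * (h x ^ k / h x)))"
  proof (rule mean_mono)
    fix x
    have "- 2 * (\<phi> x * L r x) * h x ^ k \<le> (h x / c * (L r x)\<^sup>2 + 1 / (h x / c) * (\<phi> x)\<^sup>2) * h x ^ k"
      using le[of "h x / c" x] less_imp_le[OF hq_pos(3)[of x]] c_pos by (intro mult_right_mono) auto
    then show "(- 2) * (\<phi> x * L r x * h x ^ k) \<le> 1 / c * ((L r x)\<^sup>2 * h x ^ Suc k) + c * ((\<phi> x)\<^sup>2 * (h x ^ k / h x))"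
      by (simp add: algebra_simps)
  qed (intro continuous_on_add continuous_on_mult[OF continuous_on_const] cL)+
  also have "\<dots> = 1 / c * mean d (\<lambda>x. (L r x)\<^sup>2 * h x ^ Suc k) + X"
    unfolding X_def by (rule mean_linear[OF cL(3,5)])
  finally have "2 * D \<le> 1 / c * mean d (\<lambda>x. (L r x)\<^sup>2 * h x ^ Suc k) + (1 + loss d k) * D + 2 * (loss d k * D)"
    using D fo by linarith
  then have "(1 - 3 * loss d k) * D \<le> mean d (\<lambda>x. (L r x)\<^sup>2 * h x ^ Suc k) / c"
    by (simp add: algebra_simps)
  then show "c * (1 - 3 * loss d k) * D \<le> mean d (\<lambda>x. (L r x)\<^sup>2 * h x ^ Suc k)"
    using c_pos by (simp add: pos_le_divide_eq mult_ac)
qed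

end

end

section \<open>Removing the regularisation\<close>

lemma weight_nonneg: "0 \<le> weight d x"
  unfolding weight_def by (intro sum_nonneg) simp

lemma regularisation_limit:
  assumes cf: "continuous_on (Rn d) f"
  shows "(\<lambda>n. mean d (\<lambda>x. f x * (weight d x + inverse (real (Suc n))) ^ k)) \<longlonglongrightarrow> mean d (\<lambda>x. f x * weight d x ^ k)"
proof (rule integral_dominated_convergence)
  let ?b = "\<lambda>x. \<bar>f x\<bar> * (weight d x + 1) ^ k"
  show "(\<lambda>x. f x * weight d x ^ k) \<in> borel_measurable (tor {..<d})"
    by (intro continuous_Rn_measurable continuous_intros cf continuous_weight)
  show "(\<lambda>x. f x * (weight d x + inverse (real (Suc n))) ^ k) \<in> borel_measurable (tor {..<d})" for n
    by (intro continuous_Rn_measurable continuous_intros cf continuous_weight)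
  show "integrable (tor {..<d}) ?b"
    by (intro continuous_Rn_integrable continuous_intros cf continuous_weight)
  have "(\<lambda>n. f x * (weight d x + inverse (real (Suc n))) ^ k) \<longlonglongrightarrow> f x * (weight d x + 0) ^ k" for x
    by (intro tendsto_intros LIMSEQ_inverse_real_of_nat)
  then show "AE x in tor {..<d}. (\<lambda>n. f x * (weight d x + inverse (real (Suc n))) ^ k) \<longlonglongrightarrow> f x * weight d x ^ k"
    by simp
  have i: "inverse (real (Suc n)) \<le> 1" "0 \<le> inverse (real (Suc n))" for n by (simp_all add: field_simps)
  have "norm (f x * (weight d x + inverse (real (Suc n))) ^ k) \<le> ?b x" for n x
    unfolding real_norm_def abs_mult using weight_nonneg[of d x] i[of n]
    by (intro mult_left_mono) (auto simp: power_abs[symmetric] intro!: power_mono)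
  then show "AE x in tor {..<d}. norm (f x * (weight d x + inverse (real (Suc n))) ^ k) \<le> ?b x" for n
    by simp
qed

text \<open>
  The estimates for \<open>h\<close> have constants independent of \<open>\<delta>\<close>, and only nonnegative powers of the weight
  remain in them, so dominated convergence along \<open>\<delta> = 1/(n + 1)\<close> applies.
\<close>
lemma mean_zero_inequalities:
  fixes \<phi> :: "(nat \<Rightarrow> real) \<Rightarrow> real"
  assumes hd: "high_dim d k" and p: "\<And>j. j < d \<Longrightarrow> periodic_partial d j \<phi> (p j)"
    and m0: "mean d \<phi> = 0"
  defines "S \<equiv> \<lambda>x. \<Sum>j<d. (p j x)\<^sup>2"
  shows "mean d (\<lambda>x. (\<phi> x)\<^sup>2 * weight d x ^ k) \<le> (1 + loss d k) * mean d (\<lambda>x. S x * weight d x ^ k)"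
    and "k \<ge> 1 \<Longrightarrow> real d / 2 * mean d (\<lambda>x. (\<phi> x)\<^sup>2 * weight d x ^ (k - 1)) \<le> (1 + loss d k) * mean d (\<lambda>x. S x * weight d x ^ k)"
    and "(\<And>j. j < d \<Longrightarrow> periodic_partial d j (p j) (r j)) \<Longrightarrow>
      (1 - 3 * loss d k) * mean d (\<lambda>x. S x * weight d x ^ k) \<le> mean d (\<lambda>x. (\<Sum>j<d. r j x)\<^sup>2 * weight d x ^ k)"
    and "(\<And>j. j < d \<Longrightarrow> periodic_partial d j (p j) (r j)) \<Longrightarrow>
      real d / 2 * ((1 - 3 * loss d k) * mean d (\<lambda>x. S x * weight d x ^ k)) \<le> mean d (\<lambda>x. (\<Sum>j<d. r j x)\<^sup>2 * weight d x ^ Suc k)"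
proof -
  have d1: "d \<ge> 1" using hd by (simp add: high_dim_def Suc_le_eq)
  define \<delta> where "\<delta> n = inverse (real (Suc n))" for n
  have T: "regularised_test d (\<delta> n) \<phi> p" for n
    using p d1 by unfold_locales (auto simp: \<delta>_def)
  have c\<phi>: "continuous_on (Rn d) \<phi>" using p[of 0] d1 by (simp add: periodic_partial_def)
  have cS: "continuous_on (Rn d) S"
    unfolding S_def using p by (intro continuous_intros) (simp add: periodic_partial_def)
  have c2: "continuous_on (Rn d) (\<lambda>x. (\<phi> x)\<^sup>2)" by (intro continuous_intros c\<phi>)
  note lim = regularisation_limit[folded \<delta>_def]
  have h: "regularised_weight.h d (\<delta> n) = (\<lambda>x. weight d x + \<delta> n)" for n
    using T[of n] by (intro ext) (simp add: regularised_weight.h_def regularised_test_def)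
  have D: "regularised_test.D d (\<delta> n) p k = mean d (\<lambda>x. S x * (weight d x + \<delta> n) ^ k)" for n
    unfolding regularised_test.D_def[OF T] regularised_test.S_def[OF T] h S_def ..
  show "mean d (\<lambda>x. (\<phi> x)\<^sup>2 * weight d x ^ k) \<le> (1 + loss d k) * mean d (\<lambda>x. S x * weight d x ^ k)"
  proof (rule LIMSEQ_le[OF lim[OF c2] tendsto_mult_left[OF lim[OF cS]]], intro exI allI impI)
    fix n
    show "mean d (\<lambda>x. (\<phi> x)\<^sup>2 * (weight d x + \<delta> n) ^ k) \<le> (1 + loss d k) * mean d (\<lambda>x. S x * (weight d x + \<delta> n) ^ k)"
      using regularised_test.first_order_estimates(1)[OF T hd m0, of n]
      unfolding D regularised_test.N_def[OF T] h .
  qed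
  show "real d / 2 * mean d (\<lambda>x. (\<phi> x)\<^sup>2 * weight d x ^ (k - 1)) \<le> (1 + loss d k) * mean d (\<lambda>x. S x * weight d x ^ k)"
    if k: "k \<ge> 1"
  proof (rule LIMSEQ_le[OF tendsto_mult_left[OF lim[OF c2]] tendsto_mult_left[OF lim[OF cS]]], intro exI allI impI)
    fix n
    interpret regularised_test d "\<delta> n" \<phi> p k by (rule T)
    have "(weight d x + \<delta> n) ^ k / (weight d x + \<delta> n) = (weight d x + \<delta> n) ^ (k - 1)" for x
      using k h_pos[of x] unfolding h by (cases k) auto
    then have X: "X = c * mean d (\<lambda>x. (\<phi> x)\<^sup>2 * (weight d x + \<delta> n) ^ (k - 1))"
      unfolding X_def h by simp
    have "0 \<le> mean d (\<lambda>x. (\<phi> x)\<^sup>2 * (weight d x + \<delta> n) ^ (k - 1))"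
      using weight_nonneg by (intro mean_nonneg) (simp add: \<delta>_def)
    then have "real d / 2 * mean d (\<lambda>x. (\<phi> x)\<^sup>2 * (weight d x + \<delta> n) ^ (k - 1)) \<le> X"
      unfolding X using c_ge by (rule mult_right_mono[rotated])
    also have "\<dots> \<le> (1 + loss d k) * D" by (rule first_order_estimates(2)[OF hd m0])
    finally show "real d / 2 * mean d (\<lambda>x. (\<phi> x)\<^sup>2 * (weight d x + \<delta> n) ^ (k - 1)) \<le> (1 + loss d k) * mean d (\<lambda>x. S x * (weight d x + \<delta> n) ^ k)"
      unfolding D .
  qed
  assume r: "\<And>j. j < d \<Longrightarrow> periodic_partial d j (p j) (r j)"
  have cL: "continuous_on (Rn d) (\<lambda>x. (\<Sum>j<d. r j x)\<^sup>2)"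
    using r by (intro continuous_intros) (simp add: periodic_partial_def)
  have loss: "0 \<le> 1 - 3 * loss d k" using hd by (simp add: high_dim_def)
  show "(1 - 3 * loss d k) * mean d (\<lambda>x. S x * weight d x ^ k) \<le> mean d (\<lambda>x. (\<Sum>j<d. r j x)\<^sup>2 * weight d x ^ k)"
  proof (rule LIMSEQ_le[OF tendsto_mult_left[OF lim[OF cS]] lim[OF cL]], intro exI allI impI)
    fix n
    interpret regularised_test d "\<delta> n" \<phi> p k by (rule T)
    have "(1 - 3 * loss d k) * D \<le> mean d (\<lambda>x. (L r x)\<^sup>2 * h x ^ k)"
      by (rule second_order_estimates(1)[OF r hd m0])
    then show "(1 - 3 * loss d k) * mean d (\<lambda>x. S x * (weight d x + \<delta> n) ^ k) \<le> mean d (\<lambda>x. (\<Sum>j<d. r j x)\<^sup>2 * (weight d x + \<delta> n) ^ k)"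
      unfolding D h L_def .
  qed
  show "real d / 2 * ((1 - 3 * loss d k) * mean d (\<lambda>x. S x * weight d x ^ k)) \<le> mean d (\<lambda>x. (\<Sum>j<d. r j x)\<^sup>2 * weight d x ^ Suc k)"
  proof (rule LIMSEQ_le[OF tendsto_mult_left[OF tendsto_mult_left[OF lim[OF cS]]] lim[OF cL]], intro exI allI impI)
    fix n
    interpret regularised_test d "\<delta> n" \<phi> p k by (rule T)
    have "real d / 2 * ((1 - 3 * loss d k) * D) \<le> c * ((1 - 3 * loss d k) * D)"
      using c_ge loss D_nonneg by (intro mult_right_mono mult_nonneg_nonneg)
    also have "\<dots> \<le> mean d (\<lambda>x. (L r x)\<^sup>2 * h x ^ Suc k)"
      unfolding mult.assoc[symmetric] by (rule second_order_estimates(2)[OF r hd m0])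
    finally show "real d / 2 * ((1 - 3 * loss d k) * mean d (\<lambda>x. S x * (weight d x + \<delta> n) ^ k)) \<le> mean d (\<lambda>x. (\<Sum>j<d. r j x)\<^sup>2 * (weight d x + \<delta> n) ^ Suc k)"
      unfolding D h L_def .
  qed
qed

section \<open>From differentiability classes to the four inequalities\<close>

text \<open>
  Differentiation commutes with the translation by a period, so partial derivatives stay periodic.
\<close>
lemma Ck_torus_periodic_partial:
  assumes "\<phi> \<in> Ck_torus (Suc n) d" "j < d"
  shows "periodic_partial d j \<phi> (partial_deriv j \<phi>)"
    and "Ck_Rn n d (partial_deriv j \<phi>)"
    and "x \<in> Rn d \<Longrightarrow> partial_deriv j \<phi> (x(j := x j + 2 * pi)) = partial_deriv j \<phi> x"
proof -
  have C: "continuous_on (Rn d) \<phi>" "\<forall>x\<in>Rn d. (\<lambda>t. \<phi> (x(j := t))) differentiable (at (x j))"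
     "Ck_Rn n d (partial_deriv j \<phi>)" and per: "\<forall>x\<in>Rn d. \<phi> (x(j := x j + 2 * pi)) = \<phi> x"
    using assms unfolding Ck_torus_def by auto
  have cp: "continuous_on (Rn d) (partial_deriv j \<phi>)" using C(3) by (cases n) auto
  have der: "((\<lambda>t. \<phi> (x(j := t))) has_real_derivative partial_deriv j \<phi> x) (at (x j))" if "x \<in> Rn d" for x
    using C(2) that unfolding partial_deriv_def
    by (simp add: DERIV_deriv_iff_real_differentiable)
  then show "periodic_partial d j \<phi> (partial_deriv j \<phi>)"
    using C cp per unfolding periodic_partial_def by blast
  show "Ck_Rn n d (partial_deriv j \<phi>)" by (rule C(3))
  show "partial_deriv j \<phi> (x(j := x j + 2 * pi)) = partial_deriv j \<phi> x" if x: "x \<in> Rn d"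
  proof -
    have y: "x(j := x j + 2 * pi) \<in> Rn d" using x assms(2) upd_Rn by blast
    define f where "f t = \<phi> (x(j := t))" for t
    have "f (t + 2 * pi) = f t" for t
      using per[rule_format, OF upd_Rn[OF x assms(2), of t]] by (simp add: f_def)
    then have f: "(\<lambda>t. f (t + 2 * pi)) = f" by auto
    have "(f has_real_derivative partial_deriv j \<phi> (x(j := x j + 2 * pi))) (at (x j + 2 * pi))"
      using der[OF y] by (simp add: f_def[abs_def])
    then have "(f has_real_derivative partial_deriv j \<phi> (x(j := x j + 2 * pi))) (at (x j))"
      using DERIV_shift[of f _ "x j" "2 * pi"] unfolding f by blast
    moreover have "(f has_real_derivative partial_deriv j \<phi> x) (at (x j))"
      using der[OF x] by (simp add: f_def[abs_def])
    ultimately show ?thesis by (rule DERIV_unique)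
  qed
qed

lemma C2_torus_second_partial:
  assumes "\<phi> \<in> Ck_torus 2 d" "j < d"
  shows "periodic_partial d j (partial_deriv j \<phi>) (partial_deriv j (partial_deriv j \<phi>))"
proof -
  let ?g = "partial_deriv j \<phi>"
  have g: "Ck_Rn (Suc 0) d ?g" "\<forall>x\<in>Rn d. ?g (x(j := x j + 2 * pi)) = ?g x"
    using Ck_torus_periodic_partial(2,3)[of \<phi> "Suc 0" d j] assms by (simp_all add: numeral_2_eq_2)
  have "((\<lambda>t. ?g (x(j := t))) has_real_derivative partial_deriv j ?g x) (at (x j))" if "x \<in> Rn d" for x
    using g(1) that assms(2) unfolding partial_deriv_def[of j ?g]
    by (simp add: DERIV_deriv_iff_real_differentiable)
  then show ?thesis using g assms(2) unfolding periodic_partial_def by simp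
qed

lemma grad_norm_square: "(grad_norm d \<phi> x)\<^sup>2 = (\<Sum>j<d. (partial_deriv j \<phi> x)\<^sup>2)"
  unfolding grad_norm_def L2_set_def by (rule real_sqrt_pow2) (intro sum_nonneg, simp)

lemma torus_integral_nonneg:
  assumes "\<And>x. 0 \<le> f x"
  shows "0 \<le> torus_integral d f"
  unfolding torus_integral_def set_lebesgue_integral_def
  using assms by (intro Bochner_Integration.integral_nonneg) (simp add: indicator_def)

lemma weighted_inequality_from_means:
  assumes "continuous_on (Rn d) f" "continuous_on (Rn d) g" "a * mean d f \<le> mean d g"
  shows "torus_integral d g \<ge> a * torus_integral d f"
proof -
  have "(2 * pi) ^ d * (a * mean d f) \<le> (2 * pi) ^ d * mean d g"
    using assms(3) by (intro mult_left_mono) auto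
  then show ?thesis using assms(1,2) by (simp add: torus_integral_eq_mean mult_ac)
qed

text \<open>
  The bounds only say something in high dimension; the value 1 makes them trivial elsewhere. The factor 3
  also covers the loss in the second-order estimates.
\<close>
definition eps :: "nat \<Rightarrow> nat \<Rightarrow> real" where
  "eps k d = (if high_dim d k then 3 * loss d k else 1)"

lemma eps_tendsto: "eps k \<longlonglongrightarrow> 0"
proof (rule Lim_transform_eventually)
  show "(\<lambda>d. 3 * loss d k) \<longlonglongrightarrow> 0" using tendsto_mult_left[OF loss_tendsto, of 3] by simp
  show "eventually (\<lambda>d. 3 * loss d k = eps k d) sequentially"
    using eventually_high_dim[of k] by (rule eventually_mono) (simp add: eps_def)
qed

lemma loss_nonneg: "high_dim d k \<Longrightarrow> 0 \<le> loss d k"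
  unfolding loss_def using coupling_nonneg defect_nonneg by (simp add: high_dim_def)

lemma one_minus_eps_le:
  assumes hd: "high_dim d k" and le: "N \<le> (1 + loss d k) * D" and N: "0 \<le> N" and D: "0 \<le> D"
  shows "(1 - eps k d) * N \<le> D"
proof -
  define l where "l = loss d k"
  have l: "0 \<le> l" "3 * l \<le> 1" using hd loss_nonneg[OF hd] by (auto simp: l_def high_dim_def)
  have "(1 - 3 * l) * N \<le> (1 - 3 * l) * ((1 + l) * D)"
    using le l unfolding l_def by (intro mult_left_mono) auto
  also have "\<dots> = D - (2 * l + 3 * (l * l)) * D" by (simp add: algebra_simps)
  also have "\<dots> \<le> D" using l D by simp
  finally show ?thesis using hd by (simp add: eps_def l_def)
qed

theorem proposition1p4:
  fixes \<gamma> :: nat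
  assumes "\<gamma> \<ge> 1"
  shows "(\<exists>\<epsilon> :: nat \<Rightarrow> real. \<epsilon> \<longlonglongrightarrow> 0 \<and>
           (\<forall>d\<ge>1. \<forall>\<phi>\<in>Ck_torus_mean0 1 d.
              torus_integral d (\<lambda>x. (grad_norm d \<phi> x)\<^sup>2 * weight d x ^ \<gamma>)
              \<ge> (1 - \<epsilon> d) * torus_integral d (\<lambda>x. (\<phi> x)\<^sup>2 * weight d x ^ \<gamma>)))
       \<and> (\<exists>\<epsilon> :: nat \<Rightarrow> real. \<epsilon> \<longlonglongrightarrow> 0 \<and>
           (\<forall>d\<ge>1. \<forall>\<phi>\<in>Ck_torus_mean0 1 d.
              torus_integral d (\<lambda>x. (grad_norm d \<phi> x)\<^sup>2 * weight d x ^ \<gamma>)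
              \<ge> real d / 2 * (1 - \<epsilon> d) * torus_integral d (\<lambda>x. (\<phi> x)\<^sup>2 * weight d x ^ (\<gamma> - 1))))
       \<and> (\<exists>\<epsilon> :: nat \<Rightarrow> real. \<epsilon> \<longlonglongrightarrow> 0 \<and>
           (\<forall>d\<ge>1. \<forall>\<phi>\<in>Ck_torus_mean0 2 d.
              torus_integral d (\<lambda>x. \<bar>laplacian d \<phi> x\<bar>\<^sup>2 * weight d x ^ \<gamma>)
              \<ge> (1 - \<epsilon> d) * torus_integral d (\<lambda>x. (grad_norm d \<phi> x)\<^sup>2 * weight d x ^ \<gamma>)))
       \<and> (\<exists>\<epsilon> :: nat \<Rightarrow> real. \<epsilon> \<longlonglongrightarrow> 0 \<and>
           (\<forall>d\<ge>1. \<forall>\<phi>\<in>Ck_torus_mean0 2 d.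
              torus_integral d (\<lambda>x. \<bar>laplacian d \<phi> x\<bar>\<^sup>2 * weight d x ^ \<gamma>)
              \<ge> real d / 2 * (1 - \<epsilon> d) * torus_integral d (\<lambda>x. (grad_norm d \<phi> x)\<^sup>2 * weight d x ^ (\<gamma> - 1))))"
proof -
  have first: "periodic_partial d j \<phi> (partial_deriv j \<phi>)" if "\<phi> \<in> Ck_torus (Suc n) d" "j < d" for \<phi> n d j
    using Ck_torus_periodic_partial(1)[OF that] .
  have cgrad: "continuous_on (Rn d) (\<lambda>x. (grad_norm d \<phi> x)\<^sup>2 * weight d x ^ k)"
    if "\<phi> \<in> Ck_torus (Suc n) d" for \<phi> n d k
    unfolding grad_norm_square using first[OF that]
    by (intro continuous_intros continuous_weight) (simp add: periodic_partial_def)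
  have cphi: "continuous_on (Rn d) (\<lambda>x. (\<phi> x)\<^sup>2 * weight d x ^ k)" and c\<phi>: "continuous_on (Rn d) \<phi>"
    if "\<phi> \<in> Ck_torus (Suc n) d" for \<phi> n d k
  proof -
    show c: "continuous_on (Rn d) \<phi>" using that by (simp add: Ck_torus_def)
    show "continuous_on (Rn d) (\<lambda>x. (\<phi> x)\<^sup>2 * weight d x ^ k)"
      by (intro continuous_intros continuous_weight c)
  qed
  have clap: "continuous_on (Rn d) (\<lambda>x. \<bar>laplacian d \<phi> x\<bar>\<^sup>2 * weight d x ^ k)"
    if "\<phi> \<in> Ck_torus 2 d" for \<phi> d k
    unfolding laplacian_def using C2_torus_second_partial[OF that]
    by (intro continuous_intros continuous_weight) (simp add: periodic_partial_def)
  have m0: "mean d \<phi> = 0" if "\<phi> \<in> Ck_torus (Suc n) d" "torus_integral d \<phi> = 0" for \<phi> n d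
    using that c\<phi>[OF that(1)] by (simp add: torus_integral_eq_mean)
  have lhs: "0 \<le> torus_integral d (\<lambda>x. (u x)\<^sup>2 * weight d x ^ k)" for d k u
    using weight_nonneg by (intro torus_integral_nonneg) simp
  have mnn: "0 \<le> mean d (\<lambda>x. (u x)\<^sup>2 * weight d x ^ k)" for d k u
    using weight_nonneg by (intro mean_nonneg) simp

  have 1: "torus_integral d (\<lambda>x. (grad_norm d \<phi> x)\<^sup>2 * weight d x ^ \<gamma>)
      \<ge> (1 - eps \<gamma> d) * torus_integral d (\<lambda>x. (\<phi> x)\<^sup>2 * weight d x ^ \<gamma>)"
    if "\<phi> \<in> Ck_torus_mean0 1 d" for d \<phi>
  proof (cases "high_dim d \<gamma>")
    case True
    have \<phi>: "\<phi> \<in> Ck_torus (Suc 0) d" "torus_integral d \<phi> = 0" using that by (auto simp: Ck_torus_mean0_def)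
    show ?thesis
      by (rule weighted_inequality_from_means[OF cphi[OF \<phi>(1)] cgrad[OF \<phi>(1)]], rule one_minus_eps_le[OF True _ mnn mnn])
        (use mean_zero_inequalities(1)[OF True first[OF \<phi>(1)] m0[OF \<phi>]] in \<open>simp add: grad_norm_square\<close>)
  qed (simp add: eps_def lhs)
  have 2: "torus_integral d (\<lambda>x. (grad_norm d \<phi> x)\<^sup>2 * weight d x ^ \<gamma>)
      \<ge> real d / 2 * (1 - eps \<gamma> d) * torus_integral d (\<lambda>x. (\<phi> x)\<^sup>2 * weight d x ^ (\<gamma> - 1))"
    if "\<phi> \<in> Ck_torus_mean0 1 d" for d \<phi>
  proof (cases "high_dim d \<gamma>")
    case True
    have \<phi>: "\<phi> \<in> Ck_torus (Suc 0) d" "torus_integral d \<phi> = 0" using that by (auto simp: Ck_torus_mean0_def)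
    have "(1 - eps \<gamma> d) * (real d / 2 * mean d (\<lambda>x. (\<phi> x)\<^sup>2 * weight d x ^ (\<gamma> - 1)))
       \<le> mean d (\<lambda>x. (grad_norm d \<phi> x)\<^sup>2 * weight d x ^ \<gamma>)"
      using mean_zero_inequalities(2)[OF True first[OF \<phi>(1)] m0[OF \<phi>] assms] mnn[of d \<phi>]
      by (intro one_minus_eps_le[OF True _ _ mnn]) (simp_all add: grad_norm_square)
    then show ?thesis
      by (intro weighted_inequality_from_means[OF cphi[OF \<phi>(1)] cgrad[OF \<phi>(1)]]) (simp add: mult_ac)
  qed (simp add: eps_def lhs)
  have 3: "torus_integral d (\<lambda>x. \<bar>laplacian d \<phi> x\<bar>\<^sup>2 * weight d x ^ \<gamma>)
      \<ge> (1 - eps \<gamma> d) * torus_integral d (\<lambda>x. (grad_norm d \<phi> x)\<^sup>2 * weight d x ^ \<gamma>)"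
    if "\<phi> \<in> Ck_torus_mean0 2 d" for d \<phi>
  proof (cases "high_dim d \<gamma>")
    case True
    have \<phi>2: "\<phi> \<in> Ck_torus 2 d" and \<phi>: "\<phi> \<in> Ck_torus (Suc 1) d" "torus_integral d \<phi> = 0"
      using that by (auto simp: Ck_torus_mean0_def numeral_2_eq_2)
    show ?thesis
      by (rule weighted_inequality_from_means[OF cgrad[OF \<phi>(1)] clap[OF \<phi>2]])
        (use mean_zero_inequalities(3)[OF True first[OF \<phi>(1)] m0[OF \<phi>] C2_torus_second_partial[OF \<phi>2]] True in
          \<open>simp add: grad_norm_square eps_def laplacian_def\<close>)
  qed (simp add: eps_def lhs)
  have 4: "torus_integral d (\<lambda>x. \<bar>laplacian d \<phi> x\<bar>\<^sup>2 * weight d x ^ \<gamma>)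
      \<ge> real d / 2 * (1 - eps (\<gamma> - 1) d) * torus_integral d (\<lambda>x. (grad_norm d \<phi> x)\<^sup>2 * weight d x ^ (\<gamma> - 1))"
    if "\<phi> \<in> Ck_torus_mean0 2 d" for d \<phi>
  proof (cases "high_dim d (\<gamma> - 1)")
    case True
    have \<phi>2: "\<phi> \<in> Ck_torus 2 d" and \<phi>: "\<phi> \<in> Ck_torus (Suc 1) d" "torus_integral d \<phi> = 0"
      using that by (auto simp: Ck_torus_mean0_def numeral_2_eq_2)
    have g: "Suc (\<gamma> - 1) = \<gamma>" using assms by simp
    show ?thesis
      by (rule weighted_inequality_from_means[OF cgrad[OF \<phi>(1)] clap[OF \<phi>2]])
        (use mean_zero_inequalities(4)[OF True first[OF \<phi>(1)] m0[OF \<phi>] C2_torus_second_partial[OF \<phi>2]] True in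
          \<open>simp only: grad_norm_square eps_def laplacian_def g power2_abs if_True mult.assoc\<close>)
  qed (simp add: eps_def lhs)
  show ?thesis
    using 1 2 3 4 eps_tendsto by blast
qed

end
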